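(* Let $\mathfrak{g}$ be a Lie algebra over $K$. There exists a prelie product on $\mathfrak{g}$ inducing its Lie bracket if, and only if, there exists a left ideal $I$ of $\mathcal{U}(\mathfrak{g})$ such that $\mathcal{U}_+(\mathfrak{g})=\mathfrak{g}\oplus I$. More precisely, there exists a bijection between the sets $$\mathcal{PL}(\mathfrak{g})=\{\star \mid \star \text{ is a prelie product on } \mathfrak{g} \text{ inducing the bracket of } \mathfrak{g}\},$$ $$\mathcal{LI}(\mathfrak{g})=\{I \text{ left ideal of } \mathcal{U}(\mathfrak{g}) \mid \mathcal{U}_+(\mathfrak{g})=\mathfrak{g}\oplus I\}.$$ It is given by $\Psi_{\mathfrak{g}}:\mathcal{LI}(\mathfrak{g})\longrightarrow\mathcal{PL}(\mathfrak{g})$, associating to a left ideal $I$ the prelie product defined by $x\star y=\varpi_{\mathfrak{g}}(xy)$ for $x,y\in\mathfrak{g}$ (the product $xy$ being taken in $\mathcal{U}(\mathfrak{g})$), where $\varpi_{\mathfrak{g}}$ is the canonical projection on $\mathfrak{g}$ in the direct sum $\mathcal{U}_+(\mathfrak{g})=\mathfrak{g}\oplus I$. The inverse bijection is $\Phi_{\mathfrak{g}}:\mathcal{PL}(\mathfrak{g})\longrightarrow\mathcal{LI}(\mathfrak{g})$, associating to a prelie product $\star$ the left ideal of $\mathcal{U}(\mathfrak{g})$ generated by the elements $xy-x\star y$, $x,y\in\mathfrak{g}$.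
   Context: $K$ is a commutative field of characteristic zero. $\mathcal{U}(\mathfrak{g})$ is the enveloping algebra of $\mathfrak{g}$ and $\mathcal{U}_+(\mathfrak{g})$ its augmentation ideal; $\mathfrak{g}$ is identified with its image in $\mathcal{U}(\mathfrak{g})$, and direct sums are direct sums of vector spaces. A (left) prelie product on a vector space $\mathfrak{g}$ is a bilinear product $\star$ such that $(x\star y)\star z-x\star(y\star z)=(y\star x)\star z-y\star(x\star z)$ for all $x,y,z$. It induces the bracket of the Lie algebra $\mathfrak{g}$ if $[x,y]=x\star y-y\star x$ for all $x,y\in\mathfrak{g}$. *)

theory Defs
  imports "HOL-Library.Poly_Mapping" "HOL-Algebra.QuotRing" "HOL-Algebra.Algebraic_Closure_Type"
begin

section \<open>Lie algebras and prelie products\<close>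

definition bilinear_over ::
    "('k::field \<Rightarrow> 'g::ab_group_add \<Rightarrow> 'g) \<Rightarrow> ('g \<Rightarrow> 'g \<Rightarrow> 'g) \<Rightarrow> bool"
  where "bilinear_over scale f \<longleftrightarrow>
    (\<forall>x. Vector_Spaces.linear scale scale (f x)) \<and>
    (\<forall>y. Vector_Spaces.linear scale scale (\<lambda>x. f x y))"

text \<open>The Lie algebra is the whole type \<^typ>\<open>'g\<close>, with scalar multiplication \<open>scale\<close> and
  bracket \<open>br\<close>.\<close>

locale lie_algebra = vector_space scale
  for scale :: "'k::field \<Rightarrow> 'g::ab_group_add \<Rightarrow> 'g" +
  fixes br :: "'g \<Rightarrow> 'g \<Rightarrow> 'g"
  assumes bilinear_br: "bilinear_over scale br"
    and br_self: "br x x = 0"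
    and jacobi: "br x (br y z) + br y (br z x) + br z (br x y) = 0"

definition prelie_product ::
    "('k::field \<Rightarrow> 'g::ab_group_add \<Rightarrow> 'g) \<Rightarrow> ('g \<Rightarrow> 'g \<Rightarrow> 'g) \<Rightarrow> bool"
  where "prelie_product scale star \<longleftrightarrow> bilinear_over scale star \<and>
    (\<forall>x y z. star (star x y) z - star x (star y z) = star (star y x) z - star y (star x z))"

definition induces_bracket :: "('g::ab_group_add \<Rightarrow> 'g \<Rightarrow> 'g) \<Rightarrow> ('g \<Rightarrow> 'g \<Rightarrow> 'g) \<Rightarrow> bool"
  where "induces_bracket star br \<longleftrightarrow> (\<forall>x y. br x y = star x y - star y x)"


section \<open>Left ideals of a ring\<close>

locale left_ideal = additive_subgroup I R + ring R for I and R (structure) +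
  assumes I_l_closed: "\<lbrakk>a \<in> I; x \<in> carrier R\<rbrakk> \<Longrightarrow> x \<otimes> a \<in> I"

definition genleftideal :: "('a, 'm) ring_scheme \<Rightarrow> 'a set \<Rightarrow> 'a set"
  where "genleftideal R S = \<Inter>{I. left_ideal I R \<and> S \<subseteq> I}"


section \<open>The free associative algebra on a set of letters\<close>

text \<open>Noncommutative monomials. They are wrapped in a type of their own so that concatenation
  becomes the addition of a (noncommutative) \<^class>\<open>monoid_add\<close>; finitely supported functions on
  them then form a ring with the convolution product, i.e. the free associative algebra.\<close>

datatype 'a nc_monom = Mon (letters: "'a list")

instantiation nc_monom :: (type) monoid_add
begin

definition zero_nc_monom :: "'a nc_monom" where "0 = Mon []"

definition plus_nc_monom :: "'a nc_monom \<Rightarrow> 'a nc_monom \<Rightarrow> 'a nc_monom"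
  where "u + v = Mon (letters u @ letters v)"

instance
  by standard (simp_all add: zero_nc_monom_def plus_nc_monom_def)

end

type_synonym ('a, 'k) free_alg = "'a nc_monom \<Rightarrow>\<^sub>0 'k"

definition gen :: "'a \<Rightarrow> ('a, 'k::field) free_alg"
  where "gen x = Poly_Mapping.single (Mon [x]) 1"

definition const :: "'k::field \<Rightarrow> ('a, 'k) free_alg"
  where "const c = Poly_Mapping.single 0 c"

abbreviation FreeAlg :: "('a, 'k::field) free_alg ring"
  where "FreeAlg \<equiv> ring_of_type_algebra"


section \<open>The enveloping algebra\<close>

text \<open>The first two families of relations make the generators depend linearly on the element of
  the Lie algebra, so that they cut the free algebra on the underlying set down to the tensor
  algebra; the third one is the usual relation of the enveloping algebra.\<close>

definition env_relations ::
    "('k::field \<Rightarrow> 'g::ab_group_add \<Rightarrow> 'g) \<Rightarrow> ('g \<Rightarrow> 'g \<Rightarrow> 'g) \<Rightarrow> ('g, 'k) free_alg set"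
  where "env_relations scale br =
    {gen (x + y) - (gen x + gen y) | x y. True} \<union>
    {gen (scale c x) - const c * gen x | c x. True} \<union>
    {gen x * gen y - gen y * gen x - gen (br x y) | x y. True}"

definition env_ideal ::
    "('k::field \<Rightarrow> 'g::ab_group_add \<Rightarrow> 'g) \<Rightarrow> ('g \<Rightarrow> 'g \<Rightarrow> 'g) \<Rightarrow> ('g, 'k) free_alg set"
  where "env_ideal scale br = Idl\<^bsub>FreeAlg\<^esub> (env_relations scale br)"

definition Env ::
    "('k::field \<Rightarrow> 'g::ab_group_add \<Rightarrow> 'g) \<Rightarrow> ('g \<Rightarrow> 'g \<Rightarrow> 'g) \<Rightarrow> ('g, 'k) free_alg set ring"
  where "Env scale br = FreeAlg Quot env_ideal scale br"

definition env_class ::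
    "('k::field \<Rightarrow> 'g::ab_group_add \<Rightarrow> 'g) \<Rightarrow> ('g \<Rightarrow> 'g \<Rightarrow> 'g) \<Rightarrow> ('g, 'k) free_alg \<Rightarrow> ('g, 'k) free_alg set"
  where "env_class scale br p = env_ideal scale br +>\<^bsub>FreeAlg\<^esub> p"

definition env_inj ::
    "('k::field \<Rightarrow> 'g::ab_group_add \<Rightarrow> 'g) \<Rightarrow> ('g \<Rightarrow> 'g \<Rightarrow> 'g) \<Rightarrow> 'g \<Rightarrow> ('g, 'k) free_alg set"
  where "env_inj scale br x = env_class scale br (gen x)"

definition env_scale ::
    "('k::field \<Rightarrow> 'g::ab_group_add \<Rightarrow> 'g) \<Rightarrow> ('g \<Rightarrow> 'g \<Rightarrow> 'g) \<Rightarrow> 'k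
      \<Rightarrow> ('g, 'k) free_alg set \<Rightarrow> ('g, 'k) free_alg set"
  where "env_scale scale br c u = env_class scale br (const c) \<otimes>\<^bsub>Env scale br\<^esub> u"

text \<open>The augmentation is the algebra morphism to the field vanishing on the Lie algebra: it maps
  a class to the common constant term of its representatives (see \<open>env_counit_class\<close>,
  \<open>env_counit_ring_hom\<close> and \<open>env_counit_inj\<close> below).\<close>

definition env_counit :: "('g, 'k::field) free_alg set \<Rightarrow> 'k"
  where "env_counit u = the_elem ((\<lambda>p. Poly_Mapping.lookup p 0) ` u)"

definition augmentation_ideal ::
    "('k::field \<Rightarrow> 'g::ab_group_add \<Rightarrow> 'g) \<Rightarrow> ('g \<Rightarrow> 'g \<Rightarrow> 'g) \<Rightarrow> ('g, 'k) free_alg set set"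
  where "augmentation_ideal scale br = a_kernel (Env scale br) ring_of_type_algebra env_counit"


section \<open>The two sets and the two maps\<close>

definition env_subspace ::
    "('k::field \<Rightarrow> 'g::ab_group_add \<Rightarrow> 'g) \<Rightarrow> ('g \<Rightarrow> 'g \<Rightarrow> 'g) \<Rightarrow> ('g, 'k) free_alg set set \<Rightarrow> bool"
  where "env_subspace scale br A \<longleftrightarrow> additive_subgroup A (Env scale br) \<and>
    (\<forall>c. \<forall>u\<in>A. env_scale scale br c u \<in> A)"

definition env_direct_sum ::
    "('k::field \<Rightarrow> 'g::ab_group_add \<Rightarrow> 'g) \<Rightarrow> ('g \<Rightarrow> 'g \<Rightarrow> 'g) \<Rightarrow>
      ('g, 'k) free_alg set set \<Rightarrow> ('g, 'k) free_alg set set \<Rightarrow> ('g, 'k) free_alg set set \<Rightarrow> bool"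
  where "env_direct_sum scale br V A B \<longleftrightarrow>
    env_subspace scale br A \<and> env_subspace scale br B \<and>
    V = A <+>\<^bsub>Env scale br\<^esub> B \<and> A \<inter> B = {\<zero>\<^bsub>Env scale br\<^esub>}"

definition PL :: "('k::field \<Rightarrow> 'g::ab_group_add \<Rightarrow> 'g) \<Rightarrow> ('g \<Rightarrow> 'g \<Rightarrow> 'g) \<Rightarrow> ('g \<Rightarrow> 'g \<Rightarrow> 'g) set"
  where "PL scale br = {star. prelie_product scale star \<and> induces_bracket star br}"

definition LI :: "('k::field \<Rightarrow> 'g::ab_group_add \<Rightarrow> 'g) \<Rightarrow> ('g \<Rightarrow> 'g \<Rightarrow> 'g) \<Rightarrow> ('g, 'k) free_alg set set set"
  where "LI scale br = {I. left_ideal I (Env scale br) \<and>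
    env_direct_sum scale br (augmentation_ideal scale br) (range (env_inj scale br)) I}"

text \<open>The projection onto the Lie algebra along \<open>I\<close>, with values in \<^typ>\<open>'g\<close> itself rather than in its
  image under \<^const>\<open>env_inj\<close>. The definite description is meaningful because \<^const>\<open>env_inj\<close> is
  injective (Poincare-Birkhoff-Witt).\<close>

definition env_proj ::
    "('k::field \<Rightarrow> 'g::ab_group_add \<Rightarrow> 'g) \<Rightarrow> ('g \<Rightarrow> 'g \<Rightarrow> 'g) \<Rightarrow>
      ('g, 'k) free_alg set set \<Rightarrow> ('g, 'k) free_alg set \<Rightarrow> 'g"
  where "env_proj scale br I u =
    (THE x. \<exists>i\<in>I. u = env_inj scale br x \<oplus>\<^bsub>Env scale br\<^esub> i)"

definition Psi ::
    "('k::field \<Rightarrow> 'g::ab_group_add \<Rightarrow> 'g) \<Rightarrow> ('g \<Rightarrow> 'g \<Rightarrow> 'g) \<Rightarrow>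
      ('g, 'k) free_alg set set \<Rightarrow> ('g \<Rightarrow> 'g \<Rightarrow> 'g)"
  where "Psi scale br I = (\<lambda>x y. env_proj scale br I
    (env_inj scale br x \<otimes>\<^bsub>Env scale br\<^esub> env_inj scale br y))"

definition Phi ::
    "('k::field \<Rightarrow> 'g::ab_group_add \<Rightarrow> 'g) \<Rightarrow> ('g \<Rightarrow> 'g \<Rightarrow> 'g) \<Rightarrow>
      ('g \<Rightarrow> 'g \<Rightarrow> 'g) \<Rightarrow> ('g, 'k) free_alg set set"
  where "Phi scale br star = genleftideal (Env scale br)
    {env_inj scale br x \<otimes>\<^bsub>Env scale br\<^esub> env_inj scale br y
       \<ominus>\<^bsub>Env scale br\<^esub> env_inj scale br (star x y) | x y. True}"


section \<open>Basic facts about the enveloping algebra\<close>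

lemma ring_type_simps [simp]:
  "carrier ring_of_type_algebra = UNIV"
  "x \<otimes>\<^bsub>ring_of_type_algebra\<^esub> y = x * y"
  "x \<oplus>\<^bsub>ring_of_type_algebra\<^esub> y = x + y"
  "\<one>\<^bsub>ring_of_type_algebra\<^esub> = 1"
  "\<zero>\<^bsub>ring_of_type_algebra\<^esub> = 0"
  by (simp_all add: ring_of_type_algebra_def)

lemma ring_ring_type: "ring (ring_of_type_algebra :: 'a::ring_1 ring)"
proof -
  have "\<exists>y. x + y = 0" for x :: 'a
    using add.right_inverse by blast
  thus ?thesis
    unfolding ring_of_type_algebra_def using add.right_inverse
    by unfold_locales (auto simp: algebra_simps Units_def)
qed

lemma a_inv_ring_type [simp]: "\<ominus>\<^bsub>ring_of_type_algebra\<^esub> x = - (x :: 'a::ring_1)"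
proof -
  interpret R: ring "ring_of_type_algebra :: 'a ring" by (rule ring_ring_type)
  show ?thesis using R.minus_equality[of "- x" x] by simp
qed

lemma ideal_env_ideal: "ideal (env_ideal scale br) FreeAlg"
proof -
  interpret R: ring "FreeAlg :: ('a, 'b) free_alg ring" by (rule ring_ring_type)
  show ?thesis unfolding env_ideal_def by (rule R.genideal_ideal) simp
qed

lemma ring_Env: "ring (Env scale br)"
  unfolding Env_def by (rule ideal.quotient_is_ring[OF ideal_env_ideal])

lemma env_class_ring_hom: "env_class scale br \<in> ring_hom FreeAlg (Env scale br)"
  unfolding Env_def env_class_def[abs_def] by (rule ideal.rcos_ring_hom[OF ideal_env_ideal])

lemma carrier_Env: "carrier (Env scale br) = range (env_class scale br)"
  by (auto simp: Env_def env_class_def FactRing_def A_RCOSETS_def')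

lemma env_class_mem: "q \<in> env_class scale br p \<longleftrightarrow> q - p \<in> env_ideal scale br"
proof
  assume "q - p \<in> env_ideal scale br"
  thus "q \<in> env_class scale br p"
    by (force simp: env_class_def a_r_coset_def' intro!: bexI[of _ "q - p"])
qed (auto simp: env_class_def a_r_coset_def')

lemma env_class_eq_iff:
  "env_class scale br p = env_class scale br q \<longleftrightarrow> p - q \<in> env_ideal scale br"
proof -
  interpret ideal "env_ideal scale br" FreeAlg by (rule ideal_env_ideal)
  show ?thesis using quotient_eq_iff_same_a_r_cos[OF ideal_env_ideal, of p q scale br]
    by (simp add: env_class_def a_minus_def)
qed

lemma env_relations_sub: "env_relations scale br \<subseteq> env_ideal scale br"
proof -
  interpret R: ring FreeAlg by (rule ring_ring_type)
  show ?thesis unfolding env_ideal_def by (rule R.genideal_self) simp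
qed

lemma env_inj_add:
  "env_inj scale br (x + y) = env_inj scale br x \<oplus>\<^bsub>Env scale br\<^esub> env_inj scale br y"
proof -
  have "gen (x + y) - (gen x + gen y) \<in> env_ideal scale br"
    by (rule subsetD[OF env_relations_sub]) (unfold env_relations_def, blast)
  thus ?thesis
    using ring_hom_add[OF env_class_ring_hom, of "gen x" "gen y"]
    by (simp add: env_inj_def env_class_eq_iff[symmetric])
qed

lemma env_inj_scale: "env_inj scale br (scale c x) = env_scale scale br c (env_inj scale br x)"
proof -
  have "gen (scale c x) - const c * gen x \<in> env_ideal scale br"
    by (rule subsetD[OF env_relations_sub]) (unfold env_relations_def, blast)
  thus ?thesis
    using ring_hom_mult[OF env_class_ring_hom, of "const c" "gen x"]
    by (simp add: env_inj_def env_scale_def env_class_eq_iff[symmetric])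
qed

lemma env_inj_br:
  "env_inj scale br x \<otimes>\<^bsub>Env scale br\<^esub> env_inj scale br y =
     env_inj scale br y \<otimes>\<^bsub>Env scale br\<^esub> env_inj scale br x \<oplus>\<^bsub>Env scale br\<^esub> env_inj scale br (br x y)"
proof -
  have "gen x * gen y - gen y * gen x - gen (br x y) \<in> env_ideal scale br"
    by (rule subsetD[OF env_relations_sub]) (unfold env_relations_def, blast)
  hence "env_class scale br (gen x * gen y) = env_class scale br (gen y * gen x + gen (br x y))"
    by (simp only: env_class_eq_iff diff_diff_eq)
  thus ?thesis
    unfolding env_inj_def
    using ring_hom_mult[OF env_class_ring_hom[of scale br], of "gen x" "gen y"]
      ring_hom_mult[OF env_class_ring_hom[of scale br], of "gen y" "gen x"]
      ring_hom_add[OF env_class_ring_hom[of scale br], of "gen y * gen x" "gen (br x y)"]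
    by (metis UNIV_I ring_type_simps(1,2,3))
qed

lemma free_alg_induct [case_names zero single add]:
  assumes "P 0" and "\<And>w c. P (Poly_Mapping.single w c)" and "\<And>p q. P p \<Longrightarrow> P q \<Longrightarrow> P (p + q)"
  shows "P (p :: 'a \<Rightarrow>\<^sub>0 'b::comm_monoid_add)"
proof -
  have *: "P (\<Sum>w\<in>A. Poly_Mapping.single w (Poly_Mapping.lookup p w))" if "finite A" for A
    using that by induction (auto simp: assms)
  have "p = (\<Sum>w\<in>Poly_Mapping.keys p. Poly_Mapping.single w (Poly_Mapping.lookup p w))"
    by (rule poly_mapping_eqI)
       (auto simp: lookup_sum lookup_single when_def sum.If_cases in_keys_iff Int_def
          cong: if_cong sum.cong)
  with *[of "Poly_Mapping.keys p"] show ?thesis by simp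
qed

text \<open>The universal property: a linear map \<open>f\<close> to an associative unital algebra \<open>'a\<close> (with scalar
  multiplication \<open>s\<close>) that turns the bracket into the commutator extends uniquely to an algebra
  morphism on the enveloping algebra; see \<open>env_lift_ring_hom\<close>, \<open>env_lift_inj\<close>, \<open>env_lift_scale\<close> and
  \<open>env_lift_unique\<close>.\<close>

locale env_target = vector_space s
  for s :: "'k::field \<Rightarrow> 'a::ring_1 \<Rightarrow> 'a" +
  fixes scale :: "'k \<Rightarrow> 'g::ab_group_add \<Rightarrow> 'g" and br :: "'g \<Rightarrow> 'g \<Rightarrow> 'g" and f :: "'g \<Rightarrow> 'a"
  assumes s_left: "s c (x * y) = s c x * y" and s_right: "s c (x * y) = x * s c y"
    and f_linear: "Vector_Spaces.linear scale s f"
    and f_br: "f (br u v) = f u * f v - f v * f u"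
begin

definition free_lift :: "('g, 'k) free_alg \<Rightarrow> 'a"
  where "free_lift p = (\<Sum>w\<in>Poly_Mapping.keys p.
    s (Poly_Mapping.lookup p w) (prod_list (List.map f (letters w))))"

definition env_lift :: "('g, 'k) free_alg set \<Rightarrow> 'a"
  where "env_lift u = the_elem (free_lift ` u)"

lemma free_lift_single: "free_lift (Poly_Mapping.single w c) = s c (prod_list (List.map f (letters w)))"
  by (simp add: free_lift_def)

lemma free_lift_add: "free_lift (p + q) = free_lift p + free_lift q"
  unfolding free_lift_def
  by (rule setsum_keys_plus_distrib) (simp_all add: scale_left_distrib)

lemma free_lift_0: "free_lift 0 = 0"
  by (simp add: free_lift_def)

lemma free_lift_mult: "free_lift (p * q) = free_lift p * free_lift q"
proof (induction p rule: free_alg_induct)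
  case (single w c)
  show ?case
  proof (induction q rule: free_alg_induct)
    case (single v d)
    have "s (c * d) (a * b) = s c a * s d b" for a b
      by (metis s_left s_right scale_scale)
    thus ?case by (simp add: mult_single free_lift_single plus_nc_monom_def)
  qed (simp_all add: free_lift_0 free_lift_add algebra_simps)
qed (simp_all add: free_lift_0 free_lift_add algebra_simps)

lemma free_lift_gen: "free_lift (gen x) = f x"
  by (simp add: gen_def free_lift_single)

lemma free_lift_const: "free_lift (const c) = s c 1"
  by (simp add: const_def free_lift_single zero_nc_monom_def)

lemma free_lift_diff: "free_lift (p - q) = free_lift p - free_lift q"
  using free_lift_add[of "p - q" q] by (simp add: algebra_simps)

lemma env_ideal_free_lift:
  assumes "p \<in> env_ideal scale br"
  shows "free_lift p = 0"
proof -
  interpret R: ring "FreeAlg :: ('g, 'k) free_alg ring" by (rule ring_ring_type)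
  have "ideal {p. free_lift p = 0} FreeAlg"
  proof (rule idealI)
    have "inv\<^bsub>add_monoid FreeAlg\<^esub> p = - p" for p :: "('g, 'k) free_alg"
      using a_inv_ring_type[of p] unfolding a_inv_def .
    thus "subgroup {p. free_lift p = 0} (add_monoid FreeAlg)"
      using free_lift_diff[of 0]
      by (intro R.add.subgroupI) (auto simp: free_lift_add free_lift_0 intro: exI[of _ 0])
  qed (auto simp: free_lift_mult R.ring_axioms)
  moreover have "env_relations scale br \<subseteq> {p. free_lift p = 0}"
  proof -
    interpret l: Vector_Spaces.linear scale s f by (rule f_linear)
    have "s c (f x) = s c 1 * f x" for c x by (simp add: s_left[symmetric])
    thus ?thesis
      by (auto simp: env_relations_def free_lift_diff free_lift_add free_lift_mult free_lift_gen
        free_lift_const l.add l.scale f_br)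
  qed
  ultimately have "env_ideal scale br \<subseteq> {p. free_lift p = 0}"
    unfolding env_ideal_def by (rule R.genideal_minimal)
  with assms show ?thesis by blast
qed

lemma env_lift_class: "env_lift (env_class scale br p) = free_lift p"
proof -
  have "p \<in> env_class scale br p"
    by (simp add: env_class_mem additive_subgroup.zero_closed[OF ideal.axioms(1)[OF ideal_env_ideal], simplified])
  moreover have "free_lift q = free_lift p" if "q \<in> env_class scale br p" for q
    using env_ideal_free_lift[of "q - p"] that by (simp add: env_class_mem free_lift_diff)
  ultimately have "free_lift ` env_class scale br p = {free_lift p}" by blast
  thus ?thesis by (simp add: env_lift_def)
qed

lemma env_lift_ring_hom: "env_lift \<in> ring_hom (Env scale br) ring_of_type_algebra"
proof (rule ring_hom_memI)
  note hom = env_class_ring_hom[of scale br]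
  fix u v assume "u \<in> carrier (Env scale br)" "v \<in> carrier (Env scale br)"
  then obtain p q where u: "u = env_class scale br p" "v = env_class scale br q"
    by (auto simp: carrier_Env)
  show "env_lift (u \<otimes>\<^bsub>Env scale br\<^esub> v) = env_lift u \<otimes>\<^bsub>ring_of_type_algebra\<^esub> env_lift v"
    using ring_hom_mult[OF hom, of p q] by (simp add: u env_lift_class free_lift_mult)
       (metis env_lift_class free_lift_mult)
  show "env_lift (u \<oplus>\<^bsub>Env scale br\<^esub> v) = env_lift u \<oplus>\<^bsub>ring_of_type_algebra\<^esub> env_lift v"
    using ring_hom_add[OF hom, of p q] by (simp add: u env_lift_class)
       (metis env_lift_class free_lift_add)
next
  have "free_lift 1 = 1" using free_lift_const[of 1] by (simp add: const_def)
  thus "env_lift \<one>\<^bsub>Env scale br\<^esub> = \<one>\<^bsub>ring_of_type_algebra\<^esub>"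
    using ring_hom_one[OF env_class_ring_hom[of scale br]] env_lift_class[of 1] by simp
qed simp

lemma env_lift_inj: "env_lift (env_inj scale br x) = f x"
  by (simp add: env_inj_def env_lift_class free_lift_gen)

lemma env_lift_scale:
  assumes "u \<in> carrier (Env scale br)"
  shows "env_lift (env_scale scale br c u) = s c (env_lift u)"
  using ring_hom_mult[OF env_lift_ring_hom, of "env_class scale br (const c)" u] assms
  by (simp add: env_scale_def carrier_Env env_lift_class free_lift_const s_left[symmetric])

lemma env_lift_unique:
  assumes "h \<in> ring_hom (Env scale br) ring_of_type_algebra"
    and "\<And>c u. u \<in> carrier (Env scale br) \<Longrightarrow> h (env_scale scale br c u) = s c (h u)"
    and "\<And>x. h (env_inj scale br x) = f x"
    and "u \<in> carrier (Env scale br)"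
  shows "h u = env_lift u"
proof -
  note hom = env_class_ring_hom[of scale br]
  let ?h = "\<lambda>p. h (env_class scale br p)"
  have add: "?h (p + q) = ?h p + ?h q" for p q
    using ring_hom_add[OF hom, of p q] ring_hom_add[OF assms(1), of "env_class scale br p" "env_class scale br q"]
    by (simp add: carrier_Env)
  have mult: "?h (p * q) = ?h p * ?h q" for p q
    using ring_hom_mult[OF hom, of p q] ring_hom_mult[OF assms(1), of "env_class scale br p" "env_class scale br q"]
    by (simp add: carrier_Env)
  have one: "?h 1 = 1"
    using ring_hom_one[OF hom] ring_hom_one[OF assms(1)] by simp
  have const: "?h (const c * p) = s c (?h p)" for c p
    using ring_hom_mult[OF hom, of "const c" p] assms(2)[of "env_class scale br p" c]
    by (simp add: env_scale_def carrier_Env)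
  have word: "?h (Poly_Mapping.single (Mon xs) 1) = prod_list (List.map f xs)" for xs
  proof (induction xs)
    case Nil
    show ?case using one by (simp add: zero_nc_monom_def[symmetric])
  next
    case (Cons x xs)
    have "Poly_Mapping.single (Mon (x # xs)) 1 = gen x * Poly_Mapping.single (Mon xs) (1::'k)"
      by (simp add: gen_def mult_single plus_nc_monom_def)
    thus ?case using Cons assms(3)[of x] by (simp add: mult env_inj_def)
  qed
  have "?h p = free_lift p" for p
  proof (induction p rule: free_alg_induct)
    case zero
    show ?case using add[of 0 0] by (simp add: free_lift_0)
  next
    case (single w c)
    have "const c * Poly_Mapping.single w 1 = Poly_Mapping.single w c"
      by (simp add: const_def mult_single)
    thus ?case using const[of c "Poly_Mapping.single w 1"] word[of "letters w"]
      by (simp add: free_lift_single)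
  qed (simp add: add free_lift_add)
  thus ?thesis using assms(4) by (auto simp: carrier_Env env_lift_class)
qed

end

context lie_algebra
begin

lemma env_target_counit: "env_target times scale br (\<lambda>_. 0 :: 'k)"
proof -
  have "vector_space (times :: 'k \<Rightarrow> 'k \<Rightarrow> 'k)" by unfold_locales (simp_all add: algebra_simps)
  then show ?thesis
    using vector_space_axioms
    by (auto simp: env_target_def env_target_axioms_def Vector_Spaces.linear_def
      module_hom_def module_hom_axioms_def vector_space_def Modules.module_def algebra_simps)
qed

lemma env_counit_eq_env_lift: "env_counit = env_target.env_lift times (\<lambda>_ :: 'g. 0 :: 'k)"
proof -
  interpret T: env_target "times" scale br "\<lambda>_. 0 :: 'k" by (rule env_target_counit)
  have *: "prod_list (List.map (\<lambda>_. 0) (letters w)) = (if w = 0 then 1 else 0 :: 'k)" for w :: "'g nc_monom"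
    by (cases w; cases "letters w") (auto simp: zero_nc_monom_def)
  have "T.free_lift p = Poly_Mapping.lookup p 0" for p
    by (auto simp: T.free_lift_def * in_keys_iff sum.delta if_distrib cong: if_cong)
  thus ?thesis by (simp add: fun_eq_iff env_counit_def T.env_lift_def)
qed

lemma env_counit_class: "env_counit (env_class scale br p) = Poly_Mapping.lookup p 0"
proof -
  interpret T: env_target "times" scale br "\<lambda>_. 0 :: 'k" by (rule env_target_counit)
  have *: "prod_list (List.map (\<lambda>_. 0) (letters w)) = (if w = 0 then 1 else 0 :: 'k)" for w :: "'g nc_monom"
    by (cases w; cases "letters w") (auto simp: zero_nc_monom_def)
  show ?thesis unfolding env_counit_eq_env_lift T.env_lift_class
    by (auto simp: T.free_lift_def * in_keys_iff sum.delta if_distrib cong: if_cong)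
qed

lemma env_counit_ring_hom: "env_counit \<in> ring_hom (Env scale br) ring_of_type_algebra"
  unfolding env_counit_eq_env_lift by (rule env_target.env_lift_ring_hom[OF env_target_counit])

lemma env_counit_inj: "env_counit (env_inj scale br x) = 0"
  unfolding env_counit_eq_env_lift by (rule env_target.env_lift_inj[OF env_target_counit])

end
end

theory Submission
  imports Defs
begin

text \<open>Modulo a left ideal complementing the Lie algebra, \<open>x y z\<close> is congruent to
  \<open>x \<star> (y \<star> z)\<close>, and the relation \<open>[x, y] = x y - y x\<close> of the enveloping algebra turns into
  the prelie identity. Conversely, the relations \<open>x y = x \<star> y\<close> reduce every element, modulo the
  left ideal they generate, to a scalar plus an element of the Lie algebra; nothing more collapses,
  because a prelie product makes \<open>K \<oplus> g\<close> a module over the enveloping algebra on which the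
  generators of this ideal kill \<open>(1, 0)\<close>. Two nested complements of the same subspace coincide, so
  the two constructions are inverse to each other.

  The projection along a left ideal takes values in the Lie algebra only because the Lie algebra
  embeds into its enveloping algebra. A left inverse of the embedding is the degree one part of the
  reduction of words in an ordered basis to increasing words; it is well defined by the diamond
  lemma.\<close>

section \<open>Functionals on the enveloping algebra\<close>

context lie_algebra
begin

lemma linear_iff:
  "Vector_Spaces.linear scale scale f \<longleftrightarrow>
    (\<forall>x y. f (x + y) = f x + f y) \<and> (\<forall>c x. f (scale c x) = scale c (f x))"
  using vector_space_axioms
  by (auto simp: Vector_Spaces.linear_def module_hom_def module_hom_axioms_def
    vector_space_def Modules.module_def)

lemma bilinear_over_iff:
  "bilinear_over scale f \<longleftrightarrow>
    (\<forall>x y z. f (x + y) z = f x z + f y z) \<and> (\<forall>x y z. f x (y + z) = f x y + f x z) \<and>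
    (\<forall>c x y. f (scale c x) y = scale c (f x y)) \<and> (\<forall>c x y. f x (scale c y) = scale c (f x y))"
  unfolding bilinear_over_def linear_iff by blast

lemma br_linear:
  "br (x + y) z = br x z + br y z" "br x (y + z) = br x y + br x z"
  "br (scale c x) y = scale c (br x y)" "br x (scale c y) = scale c (br x y)"
  using bilinear_br by (simp_all add: bilinear_over_iff)

lemma br_anti: "br x y = - br y x"
proof -
  have "br (x + y) (x + y) = br x y + br y x"
    by (simp only: br_linear) (simp add: br_self)
  thus ?thesis by (simp add: br_self eq_neg_iff_add_eq_0)
qed

lemma br_minus: "br (- x) y = - br x y" "br x (- y) = - br x y"
  using br_linear(1)[of x "- x" y] br_linear(1)[of 0 0 y] br_linear(2)[of x y "- y"]
    br_linear(2)[of x 0 0]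
  by (simp_all add: eq_neg_iff_add_eq_0 add.commute)

end

text \<open>The conditions on \<open>F\<close> say precisely that it extends to a linear map on the free algebra that
  factors through the enveloping algebra.\<close>

locale env_functional = lie_algebra scale br
  for scale :: "'k::field \<Rightarrow> 'g::ab_group_add \<Rightarrow> 'g" and br :: "'g \<Rightarrow> 'g \<Rightarrow> 'g" +
  fixes F :: "'g list \<Rightarrow> 'g"
  assumes F_add: "F (u @ (x + y) # v) = F (u @ x # v) + F (u @ y # v)"
    and F_scale: "F (u @ scale c x # v) = scale c (F (u @ x # v))"
    and F_commute: "F (u @ x # y # v) = F (u @ y # x # v) + F (u @ br x y # v)"
begin

definition lin_ext :: "('g, 'k) free_alg \<Rightarrow> 'g"
  where "lin_ext p = (\<Sum>w\<in>Poly_Mapping.keys p. scale (Poly_Mapping.lookup p w) (F (letters w)))"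

lemma lin_ext_single: "lin_ext (Poly_Mapping.single w c) = scale c (F (letters w))"
  by (simp add: lin_ext_def)

lemma lin_ext_0: "lin_ext 0 = 0"
  by (simp add: lin_ext_def)

lemma lin_ext_add: "lin_ext (p + q) = lin_ext p + lin_ext q"
  unfolding lin_ext_def
  by (rule setsum_keys_plus_distrib) (simp_all add: scale_left_distrib)

lemma lin_ext_diff: "lin_ext (p - q) = lin_ext p - lin_ext q"
  using lin_ext_add[of "p - q" q] by (simp add: algebra_simps)

lemma lin_ext_gen: "lin_ext (gen x) = F [x]"
  by (simp add: gen_def lin_ext_single)

lemma lin_ext_eq_0_by_monomials:
  assumes "\<And>u v c d. lin_ext (Poly_Mapping.single u c * r * Poly_Mapping.single v d) = 0"
  shows "lin_ext (p * r * q) = 0"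
proof (induction p rule: free_alg_induct)
  case (single u c)
  show ?case
    by (induction q rule: free_alg_induct) (simp_all add: lin_ext_0 lin_ext_add distrib_left assms)
qed (simp_all add: lin_ext_0 lin_ext_add distrib_right)

text \<open>Between two monomials the three families of relations turn into \<open>F_add\<close>,
  \<open>F_scale\<close> and \<open>F_commute\<close>.\<close>

lemma lin_ext_relation:
  assumes "r \<in> env_relations scale br"
  shows "lin_ext (p * r * q) = 0"
proof (rule lin_ext_eq_0_by_monomials)
  note simps = gen_def const_def right_diff_distrib left_diff_distrib distrib_left distrib_right
    lin_ext_diff lin_ext_add mult_single lin_ext_single plus_nc_monom_def zero_nc_monom_def mult_ac
  fix u v :: "'g nc_monom" and c d :: 'k
  consider (add) x y where "r = gen (x + y) - (gen x + gen y)"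
    | (scale) a x where "r = gen (scale a x) - const a * gen x"
    | (br) x y where "r = gen x * gen y - gen y * gen x - gen (br x y)"
    using assms unfolding env_relations_def by blast
  thus "lin_ext (Poly_Mapping.single u c * r * Poly_Mapping.single v d) = 0"
  proof cases
    case add
    thus ?thesis
      using F_add[of "letters u" x y "letters v"] by (simp add: simps scale_right_distrib)
  next
    case scale
    thus ?thesis
      using F_scale[of "letters u" a x "letters v"] by (simp add: simps)
  next
    case br
    thus ?thesis
      using F_commute[of "letters u" x y "letters v"] by (simp add: simps scale_right_distrib)
  qed
qed

lemma env_ideal_lin_ext:
  assumes "r \<in> env_ideal scale br"
  shows "lin_ext r = 0"
proof -
  interpret R: ring "FreeAlg :: ('g, 'k) free_alg ring" by (rule ring_ring_type)
  \<comment> \<open>The kernel of \<open>lin_ext\<close> is only a subspace. The elements all of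
    whose two-sided multiples are killed form an ideal, and \<open>p = q = 1\<close> recovers the
    claim.\<close>
  let ?N = "{r. \<forall>p q. lin_ext (p * r * q) = 0}"
  have minus: "inv\<^bsub>add_monoid FreeAlg\<^esub> p = - p" for p :: "('g, 'k) free_alg"
    using a_inv_ring_type[of p] unfolding a_inv_def .
  have neg: "lin_ext (- p) = - lin_ext p" for p
    using lin_ext_diff[of 0 p] by (simp add: lin_ext_0)
  have "ideal ?N FreeAlg"
  proof (rule idealI)
    show "subgroup ?N (add_monoid FreeAlg)"
      by (intro R.add.subgroupI)
        (auto simp: minus neg lin_ext_add lin_ext_0 distrib_left distrib_right intro: exI[of _ 0])
  next
    fix a x :: "('g, 'k) free_alg"
    assume a: "a \<in> ?N"
    have "lin_ext (p * (x * a) * q) = 0" "lin_ext (p * (a * x) * q) = 0" for p q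
      using a by (simp_all add: mult.assoc) (simp add: mult.assoc[symmetric])
    thus "x \<otimes>\<^bsub>FreeAlg\<^esub> a \<in> ?N" "a \<otimes>\<^bsub>FreeAlg\<^esub> x \<in> ?N" by simp_all
  qed (rule R.ring_axioms)
  moreover have "env_relations scale br \<subseteq> ?N"
    using lin_ext_relation by blast
  ultimately have "env_ideal scale br \<subseteq> ?N"
    unfolding env_ideal_def by (rule R.genideal_minimal)
  with assms have "lin_ext (1 * r * 1) = 0" by blast
  thus ?thesis by simp
qed

lemma lin_ext_class_eq:
  "env_class scale br p = env_class scale br q \<Longrightarrow> lin_ext p = lin_ext q"
  using env_ideal_lin_ext[of "p - q"] by (simp add: env_class_eq_iff lin_ext_diff)

end

section \<open>The Poincare-Birkhoff-Witt theorem in degree one\<close>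

locale ordered_lie_basis = lie_algebra scale br
  for scale :: "'k::field \<Rightarrow> 'g::ab_group_add \<Rightarrow> 'g" and br :: "'g \<Rightarrow> 'g \<Rightarrow> 'g" +
  fixes B :: "'g set" and lt :: "'g \<Rightarrow> 'g \<Rightarrow> bool"
  assumes indep: "independent B" and span_basis: "span B = UNIV"
    and lt_asym: "lt x y \<Longrightarrow> \<not> lt y x"
    and lt_trans: "lt x y \<Longrightarrow> lt y z \<Longrightarrow> lt x z"
    and lt_total: "x \<noteq> y \<Longrightarrow> lt x y \<or> lt y x"
begin

section \<open>Linear and multilinear extension from the basis\<close>

definition lext :: "('g \<Rightarrow> 'g) \<Rightarrow> 'g \<Rightarrow> 'g"
  where "lext = vector_space_pair.construct scale scale B"

interpretation pair: vector_space_pair scale scale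
  by unfold_locales

lemma lext_linear: "Vector_Spaces.linear scale scale (lext f)"
  unfolding lext_def by (rule pair.linear_construct[OF indep])

lemma lext_add: "lext f (x + y) = lext f x + lext f y"
  and lext_scale: "lext f (scale c x) = scale c (lext f x)"
  using lext_linear[of f] by (simp_all add: linear_iff)

lemma lext_basis: "b \<in> B \<Longrightarrow> lext f b = f b"
  unfolding lext_def by (rule pair.construct_basis[OF indep])

lemma lext_cong: "(\<And>b. b \<in> B \<Longrightarrow> f b = g b) \<Longrightarrow> lext f = lext g"
  unfolding lext_def by (rule pair.construct_cong)

lemma lext_plus: "lext (\<lambda>b. f b + g b) x = lext f x + lext g x"
  unfolding lext_def by (rule pair.construct_add[OF indep])

lemma lext_smult: "lext (\<lambda>b. scale c (f b)) x = scale c (lext f x)"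
  unfolding lext_def by (rule pair.construct_scale[OF indep])

lemma linear_eqI:
  assumes "Vector_Spaces.linear scale scale f" "Vector_Spaces.linear scale scale g"
    and "\<And>b. b \<in> B \<Longrightarrow> f b = g b"
  shows "f x = g x"
  using pair.linear_eq_on[OF assms(1,2), of x B] assms(3) span_basis by blast

text \<open>\<open>ext xs f\<close> is the value at \<open>xs\<close> of the multilinear map that agrees with \<open>f\<close> on the words
  in the basis.\<close>

primrec ext :: "'g list \<Rightarrow> ('g list \<Rightarrow> 'g) \<Rightarrow> 'g" where
  "ext [] f = f []"
| "ext (x # xs) f = lext (\<lambda>b. ext xs (\<lambda>bs. f (b # bs))) x"

lemma ext_add: "ext (u @ (x + y) # v) f = ext (u @ x # v) f + ext (u @ y # v) f"
  by (induction u arbitrary: f) (simp_all add: lext_add lext_plus)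

lemma ext_scale: "ext (u @ scale c x # v) f = scale c (ext (u @ x # v) f)"
  by (induction u arbitrary: f) (simp_all add: lext_scale lext_smult)

lemma ext_minus: "ext (u @ (- x) # v) f = - ext (u @ x # v) f"
  using ext_scale[of u "-1" x v f] by simp

lemma ext_linear: "Vector_Spaces.linear scale scale (\<lambda>x. ext (u @ x # v) f)"
  by (simp add: linear_iff ext_add ext_scale)

lemma ext_basis: "set u \<subseteq> B \<Longrightarrow> ext (u @ v) f = ext v (\<lambda>w. f (u @ w))"
  by (induction u arbitrary: f) (simp_all add: lext_basis)

lemma ext_basis': "set w \<subseteq> B \<Longrightarrow> ext w f = f w"
  using ext_basis[of w "[]"] by simp

lemma ext_plus: "ext w (\<lambda>v. f v + g v) = ext w f + ext w g"
  by (induction w arbitrary: f g) (simp_all add: lext_plus)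

lemma ext_cong:
  assumes "\<And>v. set v \<subseteq> B \<Longrightarrow> length v = length w \<Longrightarrow> f v = g v"
  shows "ext w f = ext w g"
  using assms
proof (induction w arbitrary: f g)
  case (Cons x w)
  have "ext w (\<lambda>bs. f (b # bs)) = ext w (\<lambda>bs. g (b # bs))" if "b \<in> B" for b
    using that Cons.prems by (intro Cons.IH) simp
  thus ?case by (simp cong: lext_cong)
qed simp

text \<open>Both sides are multilinear, so the rule spreads from basis words to all words. The
  bracket of two basis vectors need not be a basis vector, hence \<open>ext\<close> in the
  hypothesis. Fixing the lengths \<open>m\<close> and \<open>n\<close> lets an induction on word
  length supply that hypothesis.\<close>

lemma ext_commute:
  assumes "\<And>u v a b. \<lbrakk>length u = m; length v = n; set u \<subseteq> B; set v \<subseteq> B; a \<in> B; b \<in> B\<rbrakk> \<Longrightarrow>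
      f (u @ a # b # v) = f (u @ b # a # v) + ext (u @ br a b # v) f"
    and "length u = m" "length v = n"
  shows "ext (u @ x # y # v) f = ext (u @ y # x # v) f + ext (u @ br x y # v) f"
  using assms
proof (induction u arbitrary: f m)
  case Nil
  have cong: "ext (a # b # v) f = ext (b # a # v) f + ext (br a b # v) f" if ab: "a \<in> B" "b \<in> B" for a b
  proof -
    have "ext (a # b # v) f = ext v (\<lambda>w. f (a # b # w))"
      using ab by (simp add: lext_basis)
    also have "\<dots> = ext v (\<lambda>w. f (b # a # w) + lext (\<lambda>c. f (c # w)) (br a b))"
    proof (rule ext_cong)
      fix w assume w: "set w \<subseteq> B" "length w = length v"
      have "ext ([] @ br a b # w) f = lext (\<lambda>c. f (c # w)) (br a b)"
        by (simp add: ext_basis'[OF w(1)])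
      thus "f (a # b # w) = f (b # a # w) + lext (\<lambda>c. f (c # w)) (br a b)"
        using Nil.prems(1)[of "[]" w a b] Nil.prems(2,3) w ab by simp
    qed
    also have "\<dots> = ext v (\<lambda>w. f (b # a # w)) + ext v (\<lambda>w. lext (\<lambda>c. f (c # w)) (br a b))"
      by (rule ext_plus)
    \<comment> \<open>Extending over \<open>v\<close> and over the letter \<open>z\<close> may be
      done in either order: both sides are linear in \<open>z\<close> and agree on the
      basis.\<close>
    also have "ext v (\<lambda>w. lext (\<lambda>c. f (c # w)) z) = ext (z # v) f" for z
    proof -
      have "Vector_Spaces.linear scale scale (\<lambda>z. ext v (\<lambda>w. lext (\<lambda>c. f (c # w)) z))"
      proof -
        have "ext v (\<lambda>w. scale c (g w)) = scale c (ext v g)" for c g v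
          by (induction v arbitrary: g) (simp_all add: lext_smult)
        thus ?thesis by (simp add: linear_iff lext_add lext_scale ext_plus)
      qed
      moreover have "Vector_Spaces.linear scale scale (\<lambda>z. ext (z # v) f)"
        using ext_linear[of "[]" v f] by simp
      ultimately show ?thesis
        by (rule linear_eqI) (simp add: lext_basis)
    qed
    finally show ?thesis using ab by (simp add: lext_basis)
  qed
  \<comment> \<open>The second letter leaves the basis first, by linearity in \<open>y\<close>; the
    first letter follows in the same way.\<close>
  have "ext (a # y # v) f = ext (y # a # v) f + ext (br a y # v) f" if "a \<in> B" for a
  proof (rule linear_eqI[where f = "\<lambda>y. ext (a # y # v) f"])
    show "Vector_Spaces.linear scale scale (\<lambda>y. ext (a # y # v) f)"
      using ext_linear[of "[a]" v f] by simp
    show "Vector_Spaces.linear scale scale (\<lambda>y. ext (y # a # v) f + ext (br a y # v) f)"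
      using ext_add[of "[]" _ _ _ f] ext_scale[of "[]" _ _ _ f]
      by (simp del: ext.simps add: linear_iff br_linear scale_right_distrib)
  qed (rule cong[OF that])
  hence basis: "ext ([] @ a # y # v) f = ext ([] @ y # a # v) f + ext ([] @ br a y # v) f" if "a \<in> B" for a
    using that by (simp del: ext.simps)
  show ?case
  proof (rule linear_eqI[where f = "\<lambda>x. ext ([] @ x # y # v) f"])
    show "Vector_Spaces.linear scale scale (\<lambda>x. ext ([] @ y # x # v) f + ext ([] @ br x y # v) f)"
      using ext_add[of "[]" _ _ _ f] ext_scale[of "[]" _ _ _ f] ext_add[of "[y]" _ _ _ f]
        ext_scale[of "[y]" _ _ _ f]
      by (simp del: ext.simps add: linear_iff br_linear scale_right_distrib)
  qed (rule ext_linear basis; assumption?)+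
next
  case (Cons a u)
  \<comment> \<open>A basis vector \<open>b\<close> in front is absorbed into the function, so the
    induction hypothesis applies to \<open>\<lambda>bs. f (b # bs)\<close>; extending linearly in
    \<open>b\<close> gives the rule for \<open>a\<close>.\<close>
  have "ext (u @ x # y # v) (\<lambda>bs. f (b # bs)) =
      ext (u @ y # x # v) (\<lambda>bs. f (b # bs)) + ext (u @ br x y # v) (\<lambda>bs. f (b # bs))"
    if b: "b \<in> B" for b
  proof (rule Cons.IH[of "length u"])
    fix u' v' c d
    assume uv: "length u' = length u" "length v' = n" "set u' \<subseteq> B" "set v' \<subseteq> B" "c \<in> B" "d \<in> B"
    have "ext ((b # u') @ br c d # v') f = ext (u' @ br c d # v') (\<lambda>bs. f (b # bs))"
      using b by (simp add: lext_basis)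
    thus "f (b # u' @ c # d # v') =
        f (b # u' @ d # c # v') + ext (u' @ br c d # v') (\<lambda>bs. f (b # bs))"
      using Cons.prems(1)[of "b # u'" v' c d] Cons.prems(2) uv b by simp
  qed (use Cons.prems(3) in simp_all)
  thus ?case by (simp add: lext_plus[symmetric] cong: lext_cong)
qed

section \<open>Descents and the reduction of words\<close>

primrec inversions :: "'g list \<Rightarrow> nat" where
  "inversions [] = 0"
| "inversions (x # xs) = length (filter (\<lambda>y. lt y x) xs) + inversions xs"

text \<open>Only the pair \<open>x\<close>, \<open>y\<close> changes its relative order, so the
  count drops by one.\<close>

lemma inversions_swap:
  "lt x y \<Longrightarrow> inversions (u @ x # y # v) < inversions (u @ y # x # v)"
  by (induction u) (auto dest: lt_asym)

definition descents :: "'g list \<Rightarrow> ('g list \<times> 'g \<times> 'g \<times> 'g list) set"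
  where "descents w = {(u, y, x, v). w = u @ y # x # v \<and> lt x y}"

lemma some_descent:
  assumes "descents w \<noteq> {}" and "(u, y, x, v) = (SOME d. d \<in> descents w)"
  shows "w = u @ y # x # v" "lt x y"
proof -
  have "(u, y, x, v) \<in> descents w"
    using assms by (metis ex_in_conv someI_ex)
  thus "w = u @ y # x # v" "lt x y" by (auto simp: descents_def)
qed

text \<open>The degree one part of the reduction of a word to a combination of increasing words. The
  descent at which a reduction step is made is arbitrary; it is shown below not to matter.\<close>

function normal :: "'g list \<Rightarrow> 'g" where
  "normal w = (if descents w = {} then (if length w = 1 then hd w else 0)
    else case SOME d. d \<in> descents w of (u, y, x, v) \<Rightarrow>
      normal (u @ x # y # v) + lext (\<lambda>b. normal (u @ b # v)) (br y x))"
  by pat_completeness auto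
termination
\<comment> \<open>The exchanged word has the same length and fewer inversions; the bracket term is
  one letter shorter, whichever letter \<open>b\<close> replaces the pair.\<close>
proof (relation "length <*mlex*> measure inversions")
  show "wf (length <*mlex*> measure inversions)" by (intro wf_mlex wf_measure)
next
  fix w u d y e x v
  assume *: "descents w \<noteq> {}" and "(u, d) = (SOME d. d \<in> descents w)"
    and "(y, e) = d" "(x, v) = e"
  hence "(u, y, x, v) = (SOME d. d \<in> descents w)" by simp
  note desc = some_descent[OF *(1) this]
  show "(u @ x # y # v, w) \<in> length <*mlex*> measure inversions"
    using inversions_swap[OF desc(2)] by (intro mlex_leq) (simp_all add: desc(1))
  show "(u @ b # v, w) \<in> length <*mlex*> measure inversions" for b
    by (intro mlex_less) (simp add: desc(1))
qed

declare normal.simps [simp del]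

text \<open>\<open>normal\<close> need not be linear in the letters. Only its values on basis words
  are kept, and these are extended multilinearly, as a functional on the enveloping algebra
  requires.\<close>

abbreviation nf :: "'g list \<Rightarrow> 'g"
  where "nf w \<equiv> ext w normal"

lemma nf_add: "nf (u @ (x + y) # v) = nf (u @ x # v) + nf (u @ y # v)"
  by (rule ext_add)

lemma nf_minus: "nf (u @ (- x) # v) = - nf (u @ x # v)"
  by (rule ext_minus)

lemma nf_0: "nf (u @ 0 # v) = 0"
  using nf_add[of u 0 0 v] by simp

text \<open>One unfolding of \<open>normal\<close>: as the remaining letters lie in the basis,
  extending over the bracket letter alone already gives \<open>nf\<close>.\<close>

lemma normal_obtain_descent:
  assumes "descents w \<noteq> {}" and "set w \<subseteq> B"
  obtains u y x v where "w = u @ y # x # v" "lt x y"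
    "normal w = normal (u @ x # y # v) + nf (u @ br y x # v)"
proof -
  obtain u y x v where d: "(u, y, x, v) = (SOME d. d \<in> descents w)"
    by (metis surj_pair)
  note desc = some_descent[OF assms(1) d]
  have "nf (u @ br y x # v) = lext (\<lambda>b. normal (u @ b # v)) (br y x)"
    using assms(2) desc(1) by (simp add: ext_basis ext_basis')
  hence "normal w = normal (u @ x # y # v) + nf (u @ br y x # v)"
    using assms(1) by (subst normal.simps) (simp add: d[symmetric])
  with desc that show ?thesis by blast
qed

text \<open>Independence of the choice made in \<open>normal\<close>: any descent may serve as the
  first reduction step.\<close>

definition reducible_at :: "'g list \<Rightarrow> bool"
  where "reducible_at w \<longleftrightarrow> (\<forall>u y x v. w = u @ y # x # v \<longrightarrow> lt x y \<longrightarrow>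
    normal w = normal (u @ x # y # v) + nf (u @ br y x # v))"

lemma reducible_atD:
  "reducible_at (u @ y # x # v) \<Longrightarrow> lt x y \<Longrightarrow>
    normal (u @ y # x # v) = normal (u @ x # y # v) + nf (u @ br y x # v)"
  unfolding reducible_at_def by blast

text \<open>By multilinearity the letters may be taken in the basis. If the two are equal the
  bracket vanishes; otherwise one of the two orders is a descent, and antisymmetry of the bracket
  covers the other.\<close>

lemma nf_commute:
  assumes "\<And>w. length w = length (u @ x # y # v) \<Longrightarrow> set w \<subseteq> B \<Longrightarrow> reducible_at w"
  shows "nf (u @ x # y # v) = nf (u @ y # x # v) + nf (u @ br x y # v)"
proof (rule ext_commute[OF _ refl refl])
  fix u' v' a b
  assume uv: "length u' = length u" "length v' = length v" "set u' \<subseteq> B" "set v' \<subseteq> B" "a \<in> B" "b \<in> B"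
  consider "a = b" | "lt b a" | "lt a b" using lt_total by blast
  thus "normal (u' @ a # b # v') = normal (u' @ b # a # v') + nf (u' @ br a b # v')"
  proof cases
    case 1
    thus ?thesis by (simp add: br_self nf_0)
  next
    case 2
    thus ?thesis using uv by (intro reducible_atD assms) simp_all
  next
    case 3
    have "normal (u' @ b # a # v') = normal (u' @ a # b # v') + nf (u' @ br b a # v')"
      using uv 3 by (intro reducible_atD assms) simp_all
    thus ?thesis by (simp add: br_anti[of b a] nf_minus)
  qed
qed

text \<open>When two descents overlap, the two reductions agree by the Jacobi identity.\<close>

lemma overlap_diamond:
  assumes commute: "\<And>u' x y v'. length (u' @ x # y # v') < length (u @ a # b # c # v) \<Longrightarrow>
      nf (u' @ x # y # v') = nf (u' @ y # x # v') + nf (u' @ br x y # v')"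
    and red: "\<And>w. \<lbrakk>length w = length (u @ a # b # c # v); set w \<subseteq> B;
      inversions w < inversions (u @ a # b # c # v)\<rbrakk> \<Longrightarrow> reducible_at w"
    and B: "set (u @ a # b # c # v) \<subseteq> B"
    and lt: "lt b a" "lt c b"
  shows "normal (u @ b # a # c # v) + nf (u @ br a b # c # v) =
    normal (u @ a # c # b # v) + nf (u @ a # br b c # v)"
proof -
  have lt_ca: "lt c a" using lt_trans[OF lt(2,1)] .
  note inv = inversions_swap[OF lt(1), of u "c # v"] inversions_swap[OF lt(2), of "u @ [a]" v]
    inversions_swap[OF lt_ca, of "u @ [b]" v] inversions_swap[OF lt_ca, of u "b # v"]
  \<comment> \<open>Both sides are brought down to the word with \<open>c\<close>, \<open>b\<close>,
    \<open>a\<close> in this order; what remains are terms with one bracket.\<close>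
  have 1: "normal (u @ b # a # c # v) = normal (u @ b # c # a # v) + nf (u @ b # br a c # v)"
    using reducible_atD[of "u @ [b]" a c v] red[of "u @ b # a # c # v"] B lt_ca inv by simp
  have 2: "normal (u @ b # c # a # v) = normal (u @ c # b # a # v) + nf (u @ br b c # a # v)"
    using reducible_atD[of u b c "a # v"] red[of "u @ b # c # a # v"] B lt inv by simp
  have 3: "normal (u @ a # c # b # v) = normal (u @ c # a # b # v) + nf (u @ br a c # b # v)"
    using reducible_atD[of u a c "b # v"] red[of "u @ a # c # b # v"] B lt_ca inv by simp
  have 4: "normal (u @ c # a # b # v) = normal (u @ c # b # a # v) + nf (u @ c # br a b # v)"
    using reducible_atD[of "u @ [c]" a b v] red[of "u @ c # a # b # v"] B lt inv by simp
  \<comment> \<open>The bracket terms are one letter shorter, so their letters may be exchanged. The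
    double brackets that appear sum to zero by the Jacobi identity.\<close>
  have c: "nf (u @ x # y # v) = nf (u @ y # x # v) + nf (u @ br x y # v)" for x y
    by (rule commute) simp
  have "br (br a b) c + br (br b c) a + br (br c a) b = 0"
  proof -
    have "br (br a b) c + br (br b c) a + br (br c a) b =
        - (br a (br b c) + br b (br c a) + br c (br a b))"
      by (simp add: br_anti[of "br a b" c] br_anti[of "br b c" a] br_anti[of "br c a" b])
    thus ?thesis by (simp only: jacobi minus_zero)
  qed
  hence "nf (u @ (br (br a b) c + br (br b c) a + br (br c a) b) # v) = 0"
    by (simp only: nf_0)
  hence "nf (u @ br (br a b) c # v) + nf (u @ br (br b c) a # v) + nf (u @ br (br c a) b # v) = 0"
    by (simp only: nf_add)
  thus ?thesis
    using c[of "br a b" c] c[of "br b c" a] c[of "br a c" b]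
    by (simp add: 1 2 3 4 br_anti[of c a] br_minus nf_minus algebra_simps)
qed

text \<open>Either of two disjoint reductions can be carried out after the other, and both orders
  lead to the same four terms. In a bracket term the second exchange takes place in a shorter
  word.\<close>

lemma disjoint_diamond:
  assumes commute: "\<And>u' x y v'. length (u' @ x # y # v') < length (u @ a # b # m @ c # d # v) \<Longrightarrow>
      nf (u' @ x # y # v') = nf (u' @ y # x # v') + nf (u' @ br x y # v')"
    and red: "\<And>w. \<lbrakk>length w = length (u @ a # b # m @ c # d # v); set w \<subseteq> B;
      inversions w < inversions (u @ a # b # m @ c # d # v)\<rbrakk> \<Longrightarrow> reducible_at w"
    and B: "set (u @ a # b # m @ c # d # v) \<subseteq> B"
    and lt: "lt b a" "lt d c"
  shows "normal (u @ b # a # m @ c # d # v) + nf (u @ br a b # m @ c # d # v) =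
    normal (u @ a # b # m @ d # c # v) + nf (u @ a # b # m @ br c d # v)"
proof -
  note inv = inversions_swap[OF lt(1), of u "m @ c # d # v"]
    inversions_swap[OF lt(2), of "u @ a # b # m" v]
  have 1: "normal (u @ b # a # m @ c # d # v) =
      normal (u @ b # a # m @ d # c # v) + nf (u @ b # a # m @ br c d # v)"
    using reducible_atD[of "u @ b # a # m" c d v] red[of "u @ b # a # m @ c # d # v"] B lt inv
    by simp
  have 2: "normal (u @ a # b # m @ d # c # v) =
      normal (u @ b # a # m @ d # c # v) + nf (u @ br a b # m @ d # c # v)"
    using reducible_atD[of u a b "m @ d # c # v"] red[of "u @ a # b # m @ d # c # v"] B lt inv
    by simp
  have 3: "nf (u @ br a b # m @ c # d # v) =
      nf (u @ br a b # m @ d # c # v) + nf (u @ br a b # m @ br c d # v)"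
    using commute[of "u @ br a b # m" c d v] by simp
  have 4: "nf (u @ a # b # m @ br c d # v) =
      nf (u @ b # a # m @ br c d # v) + nf (u @ br a b # m @ br c d # v)"
    using commute[of u a b "m @ br c d # v"] by simp
  show ?thesis by (simp add: 1 2 3 4 algebra_simps)
qed

lemma diamond:
  assumes commute: "\<And>u' x y v'. length (u' @ x # y # v') < length w \<Longrightarrow>
      nf (u' @ x # y # v') = nf (u' @ y # x # v') + nf (u' @ br x y # v')"
    and red: "\<And>w'. \<lbrakk>length w' = length w; set w' \<subseteq> B; inversions w' < inversions w\<rbrakk> \<Longrightarrow>
      reducible_at w'"
    and B: "set w \<subseteq> B"
    and w: "w = u @ a # b # v" "lt b a" and w': "w = u' @ c # d # v'" "lt d c"
  shows "normal (u @ b # a # v) + nf (u @ br a b # v) = normal (u' @ d # c # v') + nf (u' @ br c d # v')"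
proof -
  \<comment> \<open>By symmetry the first descent starts no later than the second; \<open>s\<close>
    is the stretch between the two starting points. Its being empty, one letter or longer tells
    coinciding, overlapping and disjoint descents apart.\<close>
  have left: "normal (u @ b # a # v) + nf (u @ br a b # v) =
      normal (u' @ d # c # v') + nf (u' @ br c d # v')"
    if w: "w = u @ a # b # v" and lt: "lt b a" "lt d c"
      and s: "u' = u @ s" "a # b # v = s @ c # d # v'"
    for u a b v u' c d v' s
  proof -
    consider "s = []" | "s = [a]" | m where "s = a # b # m"
      using s(2) by (cases s; cases "tl s") auto
    thus ?thesis
    proof cases
      case 1
      thus ?thesis using s by simp
    next
      case 2
      hence *: "b = c" "v = d # v'" using s(2) by simp_all
      have w': "w = u @ a # c # d # v'" using w * by simp
      show ?thesis
        using overlap_diamond[OF commute[unfolded w'] red[unfolded w'] B[unfolded w']] lt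
        by (simp add: * s(1) 2)
    next
      case (3 m)
      hence *: "v = m @ c # d # v'" using s(2) by simp
      have w': "w = u @ a # b # m @ c # d # v'" using w * by simp
      show ?thesis
        using disjoint_diamond[OF commute[unfolded w'] red[unfolded w'] B[unfolded w'] lt]
        by (simp add: * s(1) 3)
    qed
  qed
  have "u @ a # b # v = u' @ c # d # v'" using w w' by simp
  then consider s where "u' = u @ s" "a # b # v = s @ c # d # v'"
    | s where "u = u' @ s" "c # d # v' = s @ a # b # v"
    by (auto simp: append_eq_append_conv2)
  thus ?thesis
  proof cases
    case (1 s)
    show ?thesis by (rule left[OF w w'(2) 1])
  next
    case (2 s)
    show ?thesis by (rule left[OF w' w(2) 2, symmetric])
  qed
qed

text \<open>Induction on length and then on inversions: shorter words supply the commutation rule,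
  words with fewer inversions the freedom of choice, and \<open>diamond\<close> compares any descent
  with the one chosen by \<open>normal\<close>.\<close>

lemma reducible_at_basis_word: "set w \<subseteq> B \<Longrightarrow> reducible_at w"
proof (induction w rule: wf_induct_rule[OF wf_mlex[OF wf_measure[of inversions], of length], case_names less])
  case (less w)
  have commute: "nf (u @ x # y # v) = nf (u @ y # x # v) + nf (u @ br x y # v)"
    if "length (u @ x # y # v) < length w" for u x y v
    using that by (intro nf_commute less.IH mlex_less) simp_all
  have red: "reducible_at w'"
    if "length w' = length w" "set w' \<subseteq> B" "inversions w' < inversions w" for w'
    using that by (intro less.IH mlex_leq) simp_all
  show ?case unfolding reducible_at_def
  proof (intro allI impI)
    fix u y x v assume w: "w = u @ y # x # v" "lt x y"
    hence "descents w \<noteq> {}" by (auto simp: descents_def)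
    then obtain u' y' x' v' where w': "w = u' @ y' # x' # v'" "lt x' y'"
      and n: "normal w = normal (u' @ x' # y' # v') + nf (u' @ br y' x' # v')"
      using less.prems by (rule normal_obtain_descent)
    show "normal w = normal (u @ x # y # v) + nf (u @ br y x # v)"
      unfolding n by (rule diamond[OF commute red less.prems w' w])
  qed
qed

section \<open>The left inverse of the embedding\<close>

lemma env_functional_nf: "env_functional scale br nf"
proof
  show "nf (u @ x # y # v) = nf (u @ y # x # v) + nf (u @ br x y # v)" for u x y v
    by (rule nf_commute) (rule reducible_at_basis_word)
qed (rule ext_add ext_scale)+

lemma nf_singleton: "nf [x] = x"
proof -
  have "normal [b] = b" for b
    by (subst normal.simps) (auto simp: descents_def Cons_eq_append_conv)
  moreover have "lext (\<lambda>b. b) x = x"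
    by (rule linear_eqI[where g = "\<lambda>x. x"]) (simp_all add: lext_add lext_scale lext_basis linear_iff)
  ultimately show ?thesis by simp
qed

lemma inj_env_inj_of_basis: "inj (env_inj scale br)"
proof (rule injI)
  interpret N: env_functional scale br nf by (rule env_functional_nf)
  fix x y assume "env_inj scale br x = env_inj scale br y"
  hence "nf [x] = nf [y]"
    unfolding env_inj_def using N.lin_ext_class_eq N.lin_ext_gen by metis
  thus "x = y" by (simp only: nf_singleton)
qed

end

theorem (in lie_algebra) inj_env_inj: "inj (env_inj scale br)"
proof -
  obtain r :: "'g rel" where r: "well_order_on UNIV r" using well_order_on by blast
  define B where "B = extend_basis {}"
  have "ordered_lie_basis scale br B (\<lambda>x y. (x, y) \<in> r \<and> x \<noteq> y)"
  proof
    show "independent B" "span B = UNIV"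
      unfolding B_def by (simp_all add: independent_extend_basis independent_empty)
  qed (use r in \<open>auto simp: well_order_on_def linear_order_on_def partial_order_on_def
    preorder_on_def total_on_def dest: antisymD transD\<close>)
  thus ?thesis by (rule ordered_lie_basis.inj_env_inj_of_basis)
qed

section \<open>Left ideals of the enveloping algebra\<close>

context ring
begin

text \<open>Negation is multiplication by \<open>\<ominus> \<one>\<close>, so closure under sums and
  left multiples already gives a subgroup.\<close>

lemma left_idealI:
  assumes "I \<subseteq> carrier R" "\<zero> \<in> I" "\<And>a b. a \<in> I \<Longrightarrow> b \<in> I \<Longrightarrow> a \<oplus> b \<in> I"
    and "\<And>a x. a \<in> I \<Longrightarrow> x \<in> carrier R \<Longrightarrow> x \<otimes> a \<in> I"
  shows "left_ideal I R"
proof -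
  have "\<ominus> a \<in> I" if "a \<in> I" for a
    using assms(4)[OF that, of "\<ominus> \<one>"] that assms(1) by (auto simp: l_minus)
  hence "subgroup I (add_monoid R)"
    using assms by (intro add.subgroupI) (auto simp: a_inv_def)
  thus ?thesis
    using assms(4) by (simp add: left_ideal_def left_ideal_axioms_def additive_subgroup_def ring_axioms)
qed

lemma genleftideal_left_ideal:
  assumes "S \<subseteq> carrier R"
  shows "left_ideal (genleftideal R S) R"
proof (rule left_idealI)
  \<comment> \<open>The carrier is one of the left ideals intersected, which keeps the intersection
    inside the ring.\<close>
  have carrier: "left_ideal (carrier R) R"
    by (rule left_idealI) auto
  thus "genleftideal R S \<subseteq> carrier R"
    using assms by (auto simp: genleftideal_def)
  show "\<zero> \<in> genleftideal R S"
    by (auto simp: genleftideal_def left_ideal_def additive_subgroup.zero_closed)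
  show "a \<oplus> b \<in> genleftideal R S" if "a \<in> genleftideal R S" "b \<in> genleftideal R S" for a b
    using that by (auto simp: genleftideal_def left_ideal_def additive_subgroup.a_closed)
  show "x \<otimes> a \<in> genleftideal R S" if "a \<in> genleftideal R S" "x \<in> carrier R" for a x
    using that by (auto simp: genleftideal_def left_ideal.I_l_closed)
qed

lemma genleftideal_self: "S \<subseteq> genleftideal R S"
  by (auto simp: genleftideal_def)

lemma genleftideal_minimal: "left_ideal I R \<Longrightarrow> S \<subseteq> I \<Longrightarrow> genleftideal R S \<subseteq> I"
  by (auto simp: genleftideal_def)

end

lemma const_commute: "const c * p = p * const c"
proof (induction p rule: free_alg_induct)
  case (single w d)
  show ?case by (simp add: const_def mult_single mult.commute)
qed (simp_all add: algebra_simps)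

lemma const_add: "const (c + d) = const c + const d"
  by (simp add: const_def single_add)

context lie_algebra
begin

section \<open>Computation with representatives in the free algebra\<close>

abbreviation "U \<equiv> Env scale br"
abbreviation "\<iota> \<equiv> env_inj scale br"
abbreviation "cl \<equiv> env_class scale br"
abbreviation "Uplus \<equiv> augmentation_ideal scale br"

interpretation U: ring U
  by (rule ring_Env)

lemma cl_closed: "cl p \<in> carrier U"
  by (simp add: carrier_Env)

lemma cl_add: "cl (p + q) = cl p \<oplus>\<^bsub>U\<^esub> cl q"
  using ring_hom_add[OF env_class_ring_hom, of p q] by simp

lemma cl_mult: "cl (p * q) = cl p \<otimes>\<^bsub>U\<^esub> cl q"
  using ring_hom_mult[OF env_class_ring_hom, of p q] by simp

lemma cl_0: "cl 0 = \<zero>\<^bsub>U\<^esub>"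
  using cl_add[of 0 0] U.add.l_cancel_one[OF cl_closed cl_closed] by (metis add_0)

lemma cl_minus: "cl (- p) = \<ominus>\<^bsub>U\<^esub> cl p"
  using cl_add[of "- p" p] U.minus_equality[OF _ cl_closed cl_closed] by (simp add: cl_0)

lemma cl_diff: "cl (p - q) = cl p \<ominus>\<^bsub>U\<^esub> cl q"
  using cl_add[of p "- q"] by (simp add: cl_minus a_minus_def)

lemma env_inj_closed: "\<iota> x \<in> carrier U"
  by (simp add: env_inj_def cl_closed)

lemma env_inj_0: "\<iota> 0 = \<zero>\<^bsub>U\<^esub>"
  using env_inj_add[of scale br 0 0] U.add.l_cancel_one[OF env_inj_closed env_inj_closed]
  by (metis add_0)

lemma env_inj_uminus: "\<iota> (- x) = \<ominus>\<^bsub>U\<^esub> \<iota> x"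
  using env_inj_add[of scale br "- x" x] U.minus_equality[OF _ env_inj_closed env_inj_closed]
  by (simp add: env_inj_0)

lemma Uplus_iff: "cl p \<in> Uplus \<longleftrightarrow> Poly_Mapping.lookup p 0 = 0"
  by (simp add: augmentation_ideal_def a_kernel_def' env_counit_class cl_closed)

lemma Uplus_cases:
  assumes "u \<in> Uplus"
  obtains p where "u = cl p" "Poly_Mapping.lookup p 0 = 0"
proof -
  have "u \<in> carrier U" using assms by (simp add: augmentation_ideal_def a_kernel_def')
  then obtain p where "u = cl p" by (auto simp: carrier_Env)
  with assms that Uplus_iff show ?thesis by simp
qed

lemma lookup_mult_0:
  "Poly_Mapping.lookup (p * q :: ('g, 'k) free_alg) 0 = Poly_Mapping.lookup p 0 * Poly_Mapping.lookup q 0"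
  using ring_hom_mult[OF env_counit_ring_hom cl_closed cl_closed, of p q]
  by (simp add: cl_mult[symmetric] env_counit_class)

lemma lookup_gen_0: "Poly_Mapping.lookup (gen x) 0 = 0"
  by (simp add: gen_def lookup_single zero_nc_monom_def)

text \<open>Every class has a representative and \<open>cl\<close> respects sums and products, so
  closure can be checked in the free algebra, where ordinary ring simplification applies.\<close>

lemma left_ideal_image_cl:
  assumes "0 \<in> N" "\<And>p q. p \<in> N \<Longrightarrow> q \<in> N \<Longrightarrow> p + q \<in> N" "\<And>p r. p \<in> N \<Longrightarrow> r * p \<in> N"
  shows "left_ideal (cl ` N) U"
proof (rule U.left_idealI)
  show "\<zero>\<^bsub>U\<^esub> \<in> cl ` N" using assms(1) cl_0 by force
  show "a \<oplus>\<^bsub>U\<^esub> b \<in> cl ` N" if "a \<in> cl ` N" "b \<in> cl ` N" for a b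
    using that assms(2) by (auto simp: cl_add[symmetric])
  show "x \<otimes>\<^bsub>U\<^esub> a \<in> cl ` N" if "a \<in> cl ` N" "x \<in> carrier U" for a x
    using that assms(3) by (auto simp: cl_mult[symmetric] carrier_Env)
qed (auto simp: cl_closed)

lemma left_ideal_Uplus: "left_ideal Uplus U"
proof -
  have "Uplus = cl ` {p. Poly_Mapping.lookup p 0 = 0}"
    using Uplus_iff by (auto elim: Uplus_cases)
  thus ?thesis
    using left_ideal_image_cl[of "{p. Poly_Mapping.lookup p 0 = 0}"]
    by (simp add: lookup_mult_0 lookup_add)
qed

text \<open>Used to test membership on representatives: identities are computed in the free algebra,
  and the relations of the enveloping algebra are then discarded.\<close>

lemma left_ideal_cl:
  assumes "left_ideal I U"
  shows "cl p \<in> I \<Longrightarrow> cl q \<in> I \<Longrightarrow> cl (p + q) \<in> I"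
    and "cl p \<in> I \<Longrightarrow> cl q \<in> I \<Longrightarrow> cl (p - q) \<in> I"
    and "cl p \<in> I \<Longrightarrow> cl (r * p) \<in> I"
    and "p \<in> env_ideal scale br \<Longrightarrow> cl p \<in> I"
proof -
  interpret I: left_ideal I U by fact
  show "cl p \<in> I \<Longrightarrow> cl q \<in> I \<Longrightarrow> cl (p + q) \<in> I"
    by (simp add: cl_add I.a_closed)
  show "cl p \<in> I \<Longrightarrow> cl q \<in> I \<Longrightarrow> cl (p - q) \<in> I"
    by (simp add: cl_diff a_minus_def I.a_closed I.a_inv_closed)
  show "cl p \<in> I \<Longrightarrow> cl (r * p) \<in> I"
    by (simp add: cl_mult I.I_l_closed cl_closed)
  assume "p \<in> env_ideal scale br"
  hence "cl p = cl 0" by (simp add: env_class_eq_iff)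
  thus "cl p \<in> I" by (simp add: cl_0 I.zero_closed)
qed

lemma gen_relations:
  "gen (x + y) - (gen x + gen y) \<in> env_ideal scale br"
  "gen (scale c x) - const c * gen x \<in> env_ideal scale br"
  "gen x * gen y - gen y * gen x - gen (br x y) \<in> env_ideal scale br"
  by (rule subsetD[OF env_relations_sub], unfold env_relations_def, blast)+

lemma env_ideal_mult_right: "p \<in> env_ideal scale br \<Longrightarrow> p * q \<in> env_ideal scale br"
  using ideal.I_r_closed[OF ideal_env_ideal, of p scale br q] by simp

section \<open>Complements of the Lie algebra in the augmentation ideal\<close>

lemma env_subspace_left_ideal: "left_ideal I U \<Longrightarrow> env_subspace scale br I"
  by (simp add: env_subspace_def env_scale_def left_ideal_def left_ideal_axioms_def cl_closed)

lemma env_subspace_range_inj: "env_subspace scale br (range \<iota>)"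
  unfolding env_subspace_def
proof
  show "additive_subgroup (range \<iota>) U"
    by (intro additive_subgroup.intro U.add.subgroupI)
      (auto simp: env_inj_closed env_inj_add[symmetric] env_inj_uminus[symmetric] a_inv_def[symmetric])
qed (auto simp: env_inj_scale[symmetric])

text \<open>A decomposition of \<open>cl p\<close> amounts to a congruence between \<open>p\<close>
  and some \<open>gen x\<close> modulo \<open>I\<close>. Injectivity of \<open>\<iota>\<close> turns
  the trivial intersection into \<open>x = 0\<close>.\<close>

lemma LI_iff:
  "I \<in> LI scale br \<longleftrightarrow> left_ideal I U \<and> I \<subseteq> Uplus \<and>
    (\<forall>p. Poly_Mapping.lookup p 0 = 0 \<longrightarrow> (\<exists>x. cl (p - gen x) \<in> I)) \<and> (\<forall>x. \<iota> x \<in> I \<longrightarrow> x = 0)"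
  (is "_ \<longleftrightarrow> ?R")
proof
  assume "I \<in> LI scale br"
  hence li: "left_ideal I U" and sum: "Uplus = range \<iota> <+>\<^bsub>U\<^esub> I" and int: "range \<iota> \<inter> I = {\<zero>\<^bsub>U\<^esub>}"
    by (auto simp: LI_def env_direct_sum_def)
  interpret I: left_ideal I U by (rule li)
  have "i \<in> Uplus" if "i \<in> I" for i
  proof -
    have "i = \<iota> 0 \<oplus>\<^bsub>U\<^esub> i" using I.a_Hcarr[OF that] by (simp add: env_inj_0)
    with that show ?thesis by (auto simp: sum set_add_def')
  qed
  moreover have "\<exists>x. cl (p - gen x) \<in> I" if "Poly_Mapping.lookup p 0 = 0" for p
  proof -
    have "cl p \<in> range \<iota> <+>\<^bsub>U\<^esub> I" using that Uplus_iff sum by simp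
    then obtain x i where i: "i \<in> I" "cl p = \<iota> x \<oplus>\<^bsub>U\<^esub> i" by (auto simp: set_add_def')
    hence "cl (p - gen x) = i"
      using I.a_Hcarr[OF i(1)] env_inj_closed[of x]
      by (simp add: cl_diff env_inj_def[symmetric] a_minus_def U.a_ac U.r_neg U.r_neg1 U.r_neg2)
    with i show ?thesis by blast
  qed
  moreover have "x = 0" if "\<iota> x \<in> I" for x
  proof -
    have "\<iota> x = \<iota> 0" using that int by (auto simp: env_inj_0)
    thus ?thesis by (rule injD[OF inj_env_inj])
  qed
  ultimately show ?R using li by blast
next
  assume R: ?R
  hence li: "left_ideal I U" by blast
  interpret I: left_ideal I U by (rule li)
  interpret P: left_ideal Uplus U by (rule left_ideal_Uplus)
  have "Uplus = range \<iota> <+>\<^bsub>U\<^esub> I"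
  proof (intro equalityI subsetI)
    fix u assume "u \<in> Uplus"
    then obtain p where p: "u = cl p" "Poly_Mapping.lookup p 0 = 0" by (rule Uplus_cases)
    with R obtain x where "cl (p - gen x) \<in> I" by blast
    moreover have "u = \<iota> x \<oplus>\<^bsub>U\<^esub> cl (p - gen x)"
      by (simp add: p(1) env_inj_def cl_add[symmetric])
    ultimately show "u \<in> range \<iota> <+>\<^bsub>U\<^esub> I" by (auto simp: set_add_def')
  next
    fix u assume "u \<in> range \<iota> <+>\<^bsub>U\<^esub> I"
    moreover have "\<iota> x \<in> Uplus" for x
      by (simp add: env_inj_def Uplus_iff lookup_gen_0)
    ultimately show "u \<in> Uplus" using R by (auto simp: set_add_def' P.a_closed)
  qed
  moreover have "range \<iota> \<inter> I = {\<zero>\<^bsub>U\<^esub>}"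
    using R I.zero_closed env_inj_0 by (auto intro: range_eqI[of _ _ 0])
  ultimately show "I \<in> LI scale br"
    using li env_subspace_left_ideal env_subspace_range_inj
    by (simp add: LI_def env_direct_sum_def)
qed

lemma LI_unique:
  assumes "I \<in> LI scale br" "cl (p - gen x) \<in> I" "cl (p - gen y) \<in> I"
  shows "x = y"
proof -
  have li: "left_ideal I U" using assms(1) LI_iff by blast
  note cl = left_ideal_cl[OF li]
  \<comment> \<open>\<open>gen\<close> is additive only modulo the relations; the additivity
    relation for \<open>x - y + y\<close> accounts for the difference.\<close>
  have "gen (x - y) = (gen (x - y + y) - (gen (x - y) + gen y)) * (- 1) + ((p - gen y) - (p - gen x))"
    by simp
  also have "cl \<dots> \<in> I"
    by (intro cl(1)[OF cl(4) cl(2)[OF assms(3,2)]] env_ideal_mult_right gen_relations)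
  finally show ?thesis using assms(1) by (auto simp: LI_iff env_inj_def)
qed

lemma env_proj_eq:
  assumes "I \<in> LI scale br" "cl (p - gen x) \<in> I"
  shows "env_proj scale br I (cl p) = x"
  unfolding env_proj_def
proof (rule the_equality)
  show "\<exists>i\<in>I. cl p = \<iota> x \<oplus>\<^bsub>U\<^esub> i"
    using assms(2) by (intro bexI[of _ "cl (p - gen x)"]) (simp_all add: env_inj_def cl_add[symmetric])
next
  fix y assume "\<exists>i\<in>I. cl p = \<iota> y \<oplus>\<^bsub>U\<^esub> i"
  then obtain i where i: "i \<in> I" "cl p = \<iota> y \<oplus>\<^bsub>U\<^esub> i" by blast
  have "left_ideal I U" using assms(1) LI_iff by blast
  then interpret I: left_ideal I U .
  have "cl (p - gen y) = i"
    using I.a_Hcarr[OF i(1)] env_inj_closed[of y] i(2)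
    by (simp add: cl_diff env_inj_def[symmetric] a_minus_def U.a_ac U.r_neg U.r_neg1 U.r_neg2)
  with LI_unique[OF assms(1) _ assms(2)] i show "y = x" by simp
qed

section \<open>From a complementary left ideal to a prelie product\<close>

lemma Psi_eq:
  assumes "I \<in> LI scale br" "cl (gen x * gen y - gen z) \<in> I"
  shows "Psi scale br I x y = z"
  using env_proj_eq[OF assms] by (simp add: Psi_def env_inj_def cl_mult)

lemma Psi_mem:
  assumes "I \<in> LI scale br"
  shows "cl (gen x * gen y - gen (Psi scale br I x y)) \<in> I"
proof -
  have "Poly_Mapping.lookup (gen x * gen y :: ('g, 'k) free_alg) 0 = 0"
    by (simp add: lookup_mult_0 lookup_gen_0)
  then obtain z where "cl (gen x * gen y - gen z) \<in> I" using assms LI_iff by blast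
  with Psi_eq[OF assms this] show ?thesis by simp
qed

text \<open>\<open>Psi_eq\<close> turns each identity into a membership in \<open>I\<close>. The
  element in question is written as a combination of multiples of the relations and left multiples
  of the elements in \<open>Psi_mem\<close>.\<close>

lemma Psi_in_PL:
  assumes I: "I \<in> LI scale br"
  shows "Psi scale br I \<in> PL scale br"
proof -
  have li: "left_ideal I U" using I LI_iff by blast
  note cl = left_ideal_cl[OF li]
  let ?s = "Psi scale br I"
  note mem = Psi_mem[OF I]
  note rel = gen_relations[THEN cl(4)]
  note rel_right = gen_relations[THEN env_ideal_mult_right, THEN cl(4)]
  note rel_left = gen_relations[THEN cl(4), THEN cl(3)]
  have addl: "?s (x + y) z = ?s x z + ?s y z" for x y z
  proof (rule Psi_eq[OF I])
    have eq: "gen (x + y) * gen z - gen (?s x z + ?s y z) =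
      (gen (x + y) - (gen x + gen y)) * gen z +
      ((gen x * gen z - gen (?s x z)) + (gen y * gen z - gen (?s y z))) -
      (gen (?s x z + ?s y z) - (gen (?s x z) + gen (?s y z)))"
      by (simp add: algebra_simps)
    show "cl (gen (x + y) * gen z - gen (?s x z + ?s y z)) \<in> I"
      unfolding eq by (rule cl(2)[OF cl(1)[OF rel_right(1) cl(1)[OF mem mem]] rel(1)])
  qed
  have addr: "?s x (y + z) = ?s x y + ?s x z" for x y z
  proof (rule Psi_eq[OF I])
    have eq: "gen x * gen (y + z) - gen (?s x y + ?s x z) =
      gen x * (gen (y + z) - (gen y + gen z)) +
      ((gen x * gen y - gen (?s x y)) + (gen x * gen z - gen (?s x z))) -
      (gen (?s x y + ?s x z) - (gen (?s x y) + gen (?s x z)))"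
      by (simp add: algebra_simps)
    show "cl (gen x * gen (y + z) - gen (?s x y + ?s x z)) \<in> I"
      unfolding eq by (rule cl(2)[OF cl(1)[OF rel_left(1) cl(1)[OF mem mem]] rel(1)])
  qed
  have scalel: "?s (scale c x) y = scale c (?s x y)" for c x y
  proof (rule Psi_eq[OF I])
    have eq: "gen (scale c x) * gen y - gen (scale c (?s x y)) =
      (gen (scale c x) - const c * gen x) * gen y + const c * (gen x * gen y - gen (?s x y)) -
      (gen (scale c (?s x y)) - const c * gen (?s x y))"
      by (simp add: algebra_simps)
    show "cl (gen (scale c x) * gen y - gen (scale c (?s x y))) \<in> I"
      unfolding eq by (rule cl(2)[OF cl(1)[OF rel_right(2) cl(3)[OF mem]] rel(2)])
  qed
  have scaler: "?s x (scale c y) = scale c (?s x y)" for c x y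
  proof (rule Psi_eq[OF I])
    have "gen x * (const c * gen y) = const c * (gen x * gen y)"
      by (simp only: mult.assoc[symmetric] const_commute[of c "gen x"])
    hence eq: "gen x * gen (scale c y) - gen (scale c (?s x y)) =
      gen x * (gen (scale c y) - const c * gen y) + const c * (gen x * gen y - gen (?s x y)) -
      (gen (scale c (?s x y)) - const c * gen (?s x y))"
      by (simp add: algebra_simps)
    show "cl (gen x * gen (scale c y) - gen (scale c (?s x y))) \<in> I"
      unfolding eq by (rule cl(2)[OF cl(1)[OF rel_left(2) cl(3)[OF mem]] rel(2)])
  qed
  have bracket: "?s x y = br x y + ?s y x" for x y
  proof (rule Psi_eq[OF I])
    have eq: "gen x * gen y - gen (br x y + ?s y x) =
      (gen x * gen y - gen y * gen x - gen (br x y)) + (gen y * gen x - gen (?s y x)) -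
      (gen (br x y + ?s y x) - (gen (br x y) + gen (?s y x)))"
      by (simp add: algebra_simps)
    show "cl (gen x * gen y - gen (br x y + ?s y x)) \<in> I"
      unfolding eq by (rule cl(2)[OF cl(1)[OF rel(3) mem] rel(1)])
  qed
  \<comment> \<open>\<open>I\<close> is a left ideal, so the congruence for the product of
    \<open>y\<close> and \<open>z\<close> may be multiplied by \<open>x\<close> on the left.\<close>
  have triple: "cl (gen x * gen y * gen z - gen (?s x (?s y z))) \<in> I" for x y z
  proof -
    have eq: "gen x * gen y * gen z - gen (?s x (?s y z)) =
      gen x * (gen y * gen z - gen (?s y z)) + (gen x * gen (?s y z) - gen (?s x (?s y z)))"
      by (simp add: algebra_simps)
    show ?thesis unfolding eq by (rule cl(1)[OF cl(3)[OF mem] mem])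
  qed
  \<comment> \<open>The relation for \<open>br x y\<close>, multiplied by \<open>z\<close> on the
    right, shows that the maps \<open>?s x\<close> represent the Lie algebra. Right multiples of
    relations still vanish in the enveloping algebra, although \<open>I\<close> is only a left
    ideal.\<close>
  have action: "?s (br x y) z + ?s y (?s x z) = ?s x (?s y z)" for x y z
  proof -
    let ?a = "?s x (?s y z)" and ?b = "?s y (?s x z)"
    have eq: "gen (br x y) * gen z - gen (?a - ?b) =
      ((gen x * gen y * gen z - gen ?a) - (gen y * gen x * gen z - gen ?b)) -
      (gen x * gen y - gen y * gen x - gen (br x y)) * gen z +
      (gen (?a - ?b + ?b) - (gen (?a - ?b) + gen ?b))"
      by (simp add: algebra_simps)
    have "cl (gen (br x y) * gen z - gen (?a - ?b)) \<in> I"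
      unfolding eq by (rule cl(1)[OF cl(2)[OF cl(2)[OF triple triple] rel_right(3)] rel(1)])
    thus ?thesis using Psi_eq[OF I, of "br x y" z] by simp
  qed
  \<comment> \<open>Once \<open>br x y\<close> is expressed through the product, the representation
    property is the prelie identity.\<close>
  have "?s (?s x y) z - ?s x (?s y z) = ?s (?s y x) z - ?s y (?s x z)" for x y z
  proof -
    have "?s (?s x y) z = ?s (br x y) z + ?s (?s y x) z"
      using addl[of "br x y" "?s y x" z] bracket[of x y] by simp
    thus ?thesis using action[of x y z] by (simp add: algebra_simps)
  qed
  moreover have "br x y = ?s x y - ?s y x" for x y
    using bracket[of x y] by simp
  ultimately show ?thesis
    unfolding PL_def prelie_product_def induces_bracket_def bilinear_over_iff
    using addl addr scalel scaler by blast
qed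

section \<open>The left ideal of a prelie product\<close>

context
  fixes star assumes star: "star \<in> PL scale br"
begin

lemma star_linear:
  "star (x + y) z = star x z + star y z" "star x (y + z) = star x y + star x z"
  "star (scale c x) y = scale c (star x y)" "star x (scale c y) = scale c (star x y)"
  using star by (simp_all add: PL_def prelie_product_def bilinear_over_iff)

lemma br_star: "br x y = star x y - star y x"
  using star by (simp add: PL_def induces_bracket_def)

text \<open>Since \<open>star\<close> induces the bracket, the prelie identity says that left
  multiplication represents the Lie algebra.\<close>

lemma star_action: "star x (star y z) = star y (star x z) + star (br x y) z"
proof -
  have "star (star x y) z - star x (star y z) = star (star y x) z - star y (star x z)"
    using star unfolding PL_def prelie_product_def by blast
  moreover have "star (star x y) z = star (br x y) z + star (star y x) z"
    using star_linear(1)[of "br x y" "star y x" z] by (simp add: br_star)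
  ultimately show ?thesis by (simp add: algebra_simps)
qed

text \<open>This functional is the projection onto the Lie algebra along the left ideal of \<open>star\<close>: it
  comes from the action \<open>x \<cdot> (c, y) = (0, c x + star x y)\<close> on \<open>K \<oplus> g\<close>, applied to \<open>(1, 0)\<close>.\<close>

fun right_normed :: "'g list \<Rightarrow> 'g" where
  "right_normed [] = 0"
| "right_normed [x] = x"
| "right_normed (x # w) = star x (right_normed w)"

lemma right_normed_Cons: "w \<noteq> [] \<Longrightarrow> right_normed (x # w) = star x (right_normed w)"
  by (cases w) simp_all

lemma env_functional_right_normed: "env_functional scale br right_normed"
proof
  fix u v :: "'g list" and x y :: 'g and c :: 'k
  show "right_normed (u @ (x + y) # v) = right_normed (u @ x # v) + right_normed (u @ y # v)"
  proof (induction u)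
    case Nil
    show ?case by (cases v) (simp_all add: star_linear)
  qed (simp add: right_normed_Cons star_linear)
  show "right_normed (u @ scale c x # v) = scale c (right_normed (u @ x # v))"
  proof (induction u)
    case Nil
    show ?case by (cases v) (simp_all add: star_linear)
  qed (simp add: right_normed_Cons star_linear)
  show "right_normed (u @ x # y # v) = right_normed (u @ y # x # v) + right_normed (u @ br x y # v)"
  proof (induction u)
    case Nil
    show ?case
    \<comment> \<open>Two final letters are exchanged because \<open>star\<close> induces the
      bracket; in front of further letters, because left multiplication is a representation.\<close>
    proof (cases v)
      case Nil
      thus ?thesis by (simp add: br_star)
    next
      case (Cons a w)
      thus ?thesis using star_action[of x y "right_normed v"] by simp
    qed
  qed (simp add: right_normed_Cons star_linear)
qed

text \<open>Evaluation starts at the right end. This is what makes the functional vanish on left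
  multiples of the generators of the ideal.\<close>

lemma right_normed_star: "right_normed (w @ [x, y]) = right_normed (w @ [star x y])"
  by (induction w) (simp_all add: right_normed_Cons)

section \<open>The generated left ideal is a complement\<close>

abbreviation "J \<equiv> Phi scale br star"

lemma Phi_eq: "J = genleftideal U {cl (gen x * gen y - gen (star x y)) | x y. True}"
  by (simp add: Phi_def env_inj_def cl_mult cl_diff)

lemma left_ideal_Phi: "left_ideal J U"
  unfolding Phi_eq by (rule U.genleftideal_left_ideal) (auto simp: cl_closed)

lemma Phi_generators: "cl (gen x * gen y - gen (star x y)) \<in> J"
  unfolding Phi_eq by (rule subsetD[OF U.genleftideal_self]) blast

lemma Phi_minimal:
  assumes "left_ideal I U" "\<And>x y. cl (gen x * gen y - gen (star x y)) \<in> I"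
  shows "J \<subseteq> I"
  unfolding Phi_eq by (rule U.genleftideal_minimal) (use assms in auto)

lemma Phi_subset_Uplus: "J \<subseteq> Uplus"
  by (rule Phi_minimal[OF left_ideal_Uplus])
    (simp add: Uplus_iff lookup_minus lookup_mult_0 lookup_gen_0)

text \<open>The elements whose left multiples are all killed by the functional give a left ideal
  containing the generators. As the functional sends \<open>gen x\<close> to \<open>x\<close>, only
  \<open>x = 0\<close> is possible.\<close>

lemma env_inj_in_Phi:
  assumes "\<iota> x \<in> J"
  shows "x = 0"
proof -
  interpret N: env_functional scale br right_normed by (rule env_functional_right_normed)
  let ?N = "{p. \<forall>q. N.lin_ext (q * p) = 0}"
  have "left_ideal (cl ` ?N) U"
    by (rule left_ideal_image_cl)
      (simp_all add: N.lin_ext_0 N.lin_ext_add distrib_left mult.assoc[symmetric])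
  moreover have "gen x * gen y - gen (star x y) \<in> ?N" for x y
  proof -
    have "N.lin_ext (q * (gen x * gen y - gen (star x y))) = 0" for q
    proof (induction q rule: free_alg_induct)
      case (single w c)
      show ?case
        using right_normed_star[of "letters w" x y]
        by (simp add: gen_def right_diff_distrib mult_single N.lin_ext_diff N.lin_ext_single
          plus_nc_monom_def)
    qed (simp_all add: N.lin_ext_0 N.lin_ext_add distrib_right)
    thus ?thesis by blast
  qed
  ultimately have "J \<subseteq> cl ` ?N" by (intro Phi_minimal) blast+
  with assms obtain p where p: "\<iota> x = cl p" "\<And>q. N.lin_ext (q * p) = 0" by blast
  have "N.lin_ext (gen x) = N.lin_ext p"
    using p(1) unfolding env_inj_def by (rule N.lin_ext_class_eq)
  thus ?thesis using p(2)[of 1] by (simp add: N.lin_ext_gen)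
qed

lemma Phi_span: "\<exists>c x. cl (p - (const c + gen x)) \<in> J"
proof -
  note cl = left_ideal_cl[OF left_ideal_Phi]
  note rel = gen_relations[THEN cl(4)]
  \<comment> \<open>\<open>gen 0\<close> is not zero in the free algebra, but its negative is the
    additivity relation for \<open>0 + 0\<close>.\<close>
  have zero_mem: "cl (0 - gen 0) \<in> J"
    using gen_relations(1)[of 0 0] cl(4) by simp
  show ?thesis
  proof (induction p rule: free_alg_induct)
    case zero
    show ?case using zero_mem by (intro exI[of _ 0]) (simp add: const_def)
  next
    case (single w c)
    have "\<exists>d x. cl (Poly_Mapping.single (Mon xs) c - (const d + gen x)) \<in> J" for xs
    proof (induction xs)
      case Nil
      show ?case using zero_mem
        by (intro exI[of _ c] exI[of _ 0]) (simp add: const_def zero_nc_monom_def)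
    next
      case (Cons a xs)
      let ?p = "Poly_Mapping.single (Mon xs) c"
      from Cons obtain d x where dx: "cl (?p - (const d + gen x)) \<in> J" by blast
      have gen_p: "Poly_Mapping.single (Mon (a # xs)) c = gen a * ?p"
        by (simp add: gen_def mult_single plus_nc_monom_def)
      \<comment> \<open>Multiplying \<open>d + x\<close> by \<open>a\<close> on the left gives
        \<open>d a + a x\<close>, which is congruent to \<open>scale d a + star a x\<close>; the
        scalar part becomes zero.\<close>
      have eq: "gen a * ?p - (const 0 + gen (scale d a + star a x)) =
        gen a * (?p - (const d + gen x)) + (gen a * gen x - gen (star a x)) -
        (gen (scale d a) - const d * gen a) -
        (gen (scale d a + star a x) - (gen (scale d a) + gen (star a x)))"
        by (simp add: const_commute[of d "gen a"] algebra_simps) (simp add: const_def)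
      have "cl (gen a * ?p - (const 0 + gen (scale d a + star a x))) \<in> J"
        unfolding eq by (rule cl(2)[OF cl(2)[OF cl(1)[OF cl(3)[OF dx] Phi_generators] rel(2)] rel(1)])
      thus ?case unfolding gen_p by blast
    qed
    from this[of "letters w"] show ?case by simp
  next
    case (add p q)
    then obtain c x d y where pq: "cl (p - (const c + gen x)) \<in> J" "cl (q - (const d + gen y)) \<in> J"
      by blast
    have eq: "p + q - (const (c + d) + gen (x + y)) =
      (p - (const c + gen x)) + (q - (const d + gen y)) - (gen (x + y) - (gen x + gen y))"
      by (simp add: const_add algebra_simps)
    have "cl (p + q - (const (c + d) + gen (x + y))) \<in> J"
      unfolding eq by (rule cl(2)[OF cl(1)[OF pq] rel(1)])
    thus ?case by blast
  qed
qed

lemma Phi_in_LI: "J \<in> LI scale br"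
proof -
  have "\<exists>x. cl (p - gen x) \<in> J" if p: "Poly_Mapping.lookup p 0 = 0" for p
  proof -
    obtain c x where cx: "cl (p - (const c + gen x)) \<in> J" using Phi_span by blast
    \<comment> \<open>The constant term vanishes on \<open>J\<close>, so \<open>c\<close> is the
      constant term of \<open>p\<close>.\<close>
    hence "Poly_Mapping.lookup (p - (const c + gen x)) 0 = 0"
      using Phi_subset_Uplus Uplus_iff by blast
    hence "c = 0"
      using p by (simp add: lookup_minus lookup_add lookup_gen_0 const_def)
    with cx show ?thesis by (auto simp: const_def)
  qed
  thus ?thesis
    using left_ideal_Phi Phi_subset_Uplus env_inj_in_Phi by (auto simp: LI_iff)
qed

section \<open>The two constructions are mutually inverse\<close>

lemma Psi_Phi: "Psi scale br J = star"
  using Psi_eq[OF Phi_in_LI Phi_generators] by blast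

end

text \<open>The generated ideal lies in \<open>I\<close>, and both are complements of the Lie
  algebra. The component \<open>x\<close> of an element of \<open>I\<close> along the generated
  ideal therefore lies in \<open>I\<close> too, hence vanishes.\<close>

lemma Phi_Psi:
  assumes I: "I \<in> LI scale br"
  shows "Phi scale br (Psi scale br I) = I"
proof
  let ?s = "Psi scale br I"
  have li: "left_ideal I U" and sub: "I \<subseteq> Uplus" using I by (simp_all add: LI_iff)
  show PI: "Phi scale br ?s \<subseteq> I"
    by (rule Phi_minimal[OF Psi_in_PL[OF I] li Psi_mem[OF I]])
  show "I \<subseteq> Phi scale br ?s"
  proof
    fix i assume i: "i \<in> I"
    with sub obtain p where p: "i = cl p" "Poly_Mapping.lookup p 0 = 0" by (blast elim: Uplus_cases)
    then obtain x where x: "cl (p - gen x) \<in> Phi scale br ?s"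
      using Phi_in_LI[OF Psi_in_PL[OF I]] by (auto simp: LI_iff)
    have "\<iota> x \<in> I"
      using left_ideal_cl(2)[OF li, of p "p - gen x"] i x PI p(1) by (auto simp: env_inj_def)
    hence "x = 0" using I by (simp add: LI_iff)
    hence "cl (gen x) = cl 0" using env_inj_0 cl_0 by (simp add: env_inj_def)
    hence "gen x \<in> env_ideal scale br" by (simp add: env_class_eq_iff)
    with x left_ideal_cl(1,4)[OF left_ideal_Phi[OF Psi_in_PL[OF I]]] p(1)
    show "i \<in> Phi scale br ?s" by (metis diff_add_cancel)
  qed
qed

end

theorem theorem11:
  fixes scale :: "'k::field_char_0 \<Rightarrow> 'g::ab_group_add \<Rightarrow> 'g"
    and br :: "'g \<Rightarrow> 'g \<Rightarrow> 'g"
  assumes "lie_algebra scale br"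
  shows "((\<exists>star. prelie_product scale star \<and> induces_bracket star br) \<longleftrightarrow>
          (\<exists>I. left_ideal I (Env scale br) \<and>
               env_direct_sum scale br (augmentation_ideal scale br) (range (env_inj scale br)) I)) \<and>
         bij_betw (Psi scale br) (LI scale br) (PL scale br) \<and>
         bij_betw (Phi scale br) (PL scale br) (LI scale br) \<and>
         (\<forall>I\<in>LI scale br. Phi scale br (Psi scale br I) = I) \<and>
         (\<forall>star\<in>PL scale br. Psi scale br (Phi scale br star) = star)"
proof -
  interpret lie_algebra scale br by fact
  have inverse: "\<forall>I\<in>LI scale br. Phi scale br (Psi scale br I) = I"
    "\<forall>star\<in>PL scale br. Psi scale br (Phi scale br star) = star"
    using Phi_Psi Psi_Phi by blast+
  have maps: "Psi scale br ` LI scale br \<subseteq> PL scale br" "Phi scale br ` PL scale br \<subseteq> LI scale br"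
    using Psi_in_PL Phi_in_LI by blast+
  have "bij_betw (Psi scale br) (LI scale br) (PL scale br)"
    "bij_betw (Phi scale br) (PL scale br) (LI scale br)"
    using inverse maps by (auto intro: bij_betw_byWitness)
  moreover have "PL scale br \<noteq> {} \<longleftrightarrow> LI scale br \<noteq> {}" using maps by blast
  hence "(\<exists>star. prelie_product scale star \<and> induces_bracket star br) \<longleftrightarrow>
      (\<exists>I. left_ideal I (Env scale br) \<and>
        env_direct_sum scale br (augmentation_ideal scale br) (range (env_inj scale br)) I)"
    by (auto simp: PL_def LI_def)
  ultimately show ?thesis using inverse by blast
qed

end
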